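(* Let $k, \ell, D \in \mathbb{N}$ with $k \geq 1$, let $\epsilon > 0$ and let $\alpha \in \{0,1\}$. Then there exist simple graphs $G$ with $$\gamma(G) < k + \frac{\ell(k+1) + \alpha}{(\ell+1)(k+1) + \alpha} + \epsilon$$ such that $G$ has no decomposition into $k+1$ pseudoforests in which one of the pseudoforests has maximum degree at most $D$ and every connected component of that pseudoforest has diameter less than $2\ell + 1 + \alpha$.
   Context: A pseudoforest is a graph in which every connected component contains at most one cycle; a decomposition of $G$ is a partition of $E(G)$. The fractional arboricity of $G$ is $\gamma(G) = \max\{ e(H)/(v(H)-1) : H \subseteq G,\ v(H) \geq 2\}$, where $e(H), v(H)$ are the numbers of edges and vertices of $H$. The diameter of a connected graph is the maximum distance between two of its vertices. *)

theory Defs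
  imports Complex_Main "HOL-Library.Disjoint_Sets"
begin

record 'a graph =
  verts :: "'a set"
  edges :: "'a set set"

definition simple_graph :: "'a graph \<Rightarrow> bool" where
  "simple_graph G \<longleftrightarrow> finite (verts G) \<and> verts G \<noteq> {} \<and>
     (\<forall>e\<in>edges G. e \<subseteq> verts G \<and> card e = 2)"

definition subgraph :: "'a graph \<Rightarrow> 'a graph \<Rightarrow> bool" where
  "subgraph H G \<longleftrightarrow> simple_graph H \<and> verts H \<subseteq> verts G \<and> edges H \<subseteq> edges G"

text \<open>The maximum is over a nonempty set only if \<open>G\<close> has at least two vertices. A graph with
  a single vertex has no edges.\<close>

definition fractional_arboricity :: "'a graph \<Rightarrow> real" where
  "fractional_arboricity G =
     Max {real (card (edges H)) / (real (card (verts H)) - 1) | H.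
            subgraph H G \<and> card (verts H) \<ge> 2}"

definition degree :: "'a graph \<Rightarrow> 'a \<Rightarrow> nat" where
  "degree G v = card {e \<in> edges G. v \<in> e}"

definition max_degree :: "'a graph \<Rightarrow> nat" where
  "max_degree G = Max (degree G ` verts G)"

definition walk_betw :: "'a graph \<Rightarrow> 'a \<Rightarrow> 'a list \<Rightarrow> 'a \<Rightarrow> bool" where
  "walk_betw G u p v \<longleftrightarrow> p \<noteq> [] \<and> hd p = u \<and> last p = v \<and> set p \<subseteq> verts G \<and>
     successively (\<lambda>x y. {x, y} \<in> edges G) p"

definition connected_graph :: "'a graph \<Rightarrow> bool" where
  "connected_graph G \<longleftrightarrow> (\<forall>u\<in>verts G. \<forall>v\<in>verts G. \<exists>p. walk_betw G u p v)"

text \<open>The distance counts edges. It is meaningful only for vertices joined by a walk, and so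
  the diameter only for connected graphs.\<close>

definition distance :: "'a graph \<Rightarrow> 'a \<Rightarrow> 'a \<Rightarrow> nat" where
  "distance G u v = (LEAST n. \<exists>p. walk_betw G u p v \<and> length p = Suc n)"

definition graph_diameter :: "'a graph \<Rightarrow> nat" where
  "graph_diameter G = Max {distance G u v | u v. u \<in> verts G \<and> v \<in> verts G}"

definition component :: "'a graph \<Rightarrow> 'a graph \<Rightarrow> bool" where
  "component C G \<longleftrightarrow> subgraph C G \<and> connected_graph C \<and>
     (\<forall>H. subgraph H G \<and> connected_graph H \<and> subgraph C H \<longrightarrow> H = C)"

text \<open>A cycle is a graph, so the same cycle traversed from another vertex or in the other
  direction is not a second cycle.\<close>

definition is_cycle :: "'a graph \<Rightarrow> bool" where
  "is_cycle C \<longleftrightarrow> (\<exists>vs. distinct vs \<and> length vs \<ge> 3 \<and> verts C = set vs \<and>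
     edges C = {{vs ! i, vs ! (Suc i mod length vs)} | i. i < length vs})"

definition pseudoforest :: "'a graph \<Rightarrow> bool" where
  "pseudoforest G \<longleftrightarrow> simple_graph G \<and>
     (\<forall>K. component K G \<longrightarrow>
        (\<forall>C C'. is_cycle C \<and> subgraph C K \<and> is_cycle C' \<and> subgraph C' K \<longrightarrow> C = C'))"

text \<open>Parts of a decomposition may be empty. Each part is read as a graph on all vertices
  of \<open>G\<close>.\<close>

definition decomposition :: "'a graph \<Rightarrow> nat \<Rightarrow> (nat \<Rightarrow> 'a set set) \<Rightarrow> bool" where
  "decomposition G n F \<longleftrightarrow>
     (\<Union>i<n. F i) = edges G \<and> disjoint_family_on F {..<n}"

definition spanning :: "'a graph \<Rightarrow> 'a set set \<Rightarrow> 'a graph" where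
  "spanning G A = \<lparr>verts = verts G, edges = A\<rparr>"

end

theory Submission
  imports Defs
begin

text \<open>
  Take many copies of a tree and join their vertices to \<open>k\<close> common hubs. A pseudoforest has at most as many
  edges as vertices, so \<open>k\<close> of the pseudoforests leave an excess of edges to the remaining one, \<open>F\<close>. Since
  \<open>F\<close> has bounded degree, it uses only boundedly many edges at the hubs, so most copies meet \<open>F\<close> only
  in tree edges. The tree has \<open>(k + 1) N + 1\<close> marked path ends at pairwise distance at least
  \<open>2 l + 1 + \<alpha>\<close>. If all components of \<open>F\<close> have smaller diameter, the ends lie in different components,
  so at least \<open>(k + 1) N\<close> tree edges of such a copy are missing from \<open>F\<close>. The numbers of hub edges are
  chosen so that the \<open>k\<close> other pseudoforests have room for only \<open>(k + 1) N - 1\<close> of them per copy, while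
  the two units by which the hub edges exceed the critical density sit at opposite ends of a long chain, so
  that only large subgraphs contain both.
\<close>

subsection \<open>Pseudoforests have at most as many edges as vertices\<close>

text \<open>Reachability is handled through the reflexive transitive closure of this relation, so
  that it admits rule induction.\<close>

definition adj :: "'a graph \<Rightarrow> ('a \<times> 'a) set" where
  "adj G = {(x, y). x \<in> verts G \<and> y \<in> verts G \<and> {x, y} \<in> edges G}"

lemma sym_adj: "sym (adj G)"
  by (auto simp: adj_def sym_def insert_commute)

lemma adj_rtrancl_sym: "(u, v) \<in> (adj G)\<^sup>* \<Longrightarrow> (v, u) \<in> (adj G)\<^sup>*"
  using sym_rtrancl[OF sym_adj] by (meson symD)

lemma walk_betw_imp_rtrancl: "walk_betw G u p v \<Longrightarrow> (u, v) \<in> (adj G)\<^sup>*"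
proof (induction p arbitrary: u)
  case Nil
  then show ?case by (simp add: walk_betw_def)
next
  case (Cons a p)
  show ?case
  proof (cases p)
    case Nil
    with Cons.prems show ?thesis by (auto simp: walk_betw_def)
  next
    case (Cons b q)
    have "walk_betw G b p v" "(u, b) \<in> adj G"
      using Cons.prems Cons by (auto simp: walk_betw_def adj_def)
    then show ?thesis using Cons.IH by (meson converse_rtrancl_into_rtrancl)
  qed
qed

lemma rtrancl_imp_walk_betw:
  assumes "(u, v) \<in> (adj G)\<^sup>*" "u \<in> verts G"
  shows "\<exists>p. walk_betw G u p v"
  using assms
proof (induction rule: rtrancl_induct)
  case base
  then have "walk_betw G u [u] u" by (simp add: walk_betw_def)
  then show ?case by blast
next
  case (step y z)
  then obtain p where p: "walk_betw G u p y" by blast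
  have "walk_betw G u (p @ [z]) z"
    using p step.hyps(2) by (auto simp: walk_betw_def adj_def successively_append_iff)
  then show ?case by blast
qed

lemma connected_graph_iff:
  "connected_graph G \<longleftrightarrow> (\<forall>u\<in>verts G. \<forall>v\<in>verts G. (u, v) \<in> (adj G)\<^sup>*)"
  unfolding connected_graph_def
  using walk_betw_imp_rtrancl rtrancl_imp_walk_betw by metis

definition component_of :: "'a graph \<Rightarrow> 'a \<Rightarrow> 'a graph" where
  "component_of G a = \<lparr>verts = {v. (a, v) \<in> (adj G)\<^sup>*},
     edges = {e \<in> edges G. e \<subseteq> {v. (a, v) \<in> (adj G)\<^sup>*}}\<rparr>"

lemma reach_in_verts: "(a, v) \<in> (adj G)\<^sup>* \<Longrightarrow> a \<in> verts G \<Longrightarrow> v \<in> verts G"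
  by (induction rule: rtrancl_induct) (auto simp: adj_def)

lemma adj_mono: "verts H \<subseteq> verts G \<Longrightarrow> edges H \<subseteq> edges G \<Longrightarrow> adj H \<subseteq> adj G"
  by (auto simp: adj_def)

text \<open>In a connected subgraph containing \<open>a\<close> every vertex is reachable from
  \<open>a\<close>, which gives maximality. For connectedness, paths from \<open>a\<close> in
  \<open>G\<close> never leave the reachable set.\<close>

lemma component_component_of:
  assumes G: "simple_graph G" and a: "a \<in> verts G"
  shows "component (component_of G a) G"
proof -
  let ?C = "component_of G a"
  have vC: "verts ?C \<subseteq> verts G"
    using reach_in_verts[OF _ a] by (auto simp: component_of_def)
  have aC: "a \<in> verts ?C"
    by (simp add: component_of_def)
  have "simple_graph ?C"
    using G vC aC finite_subset[OF vC]
    by (auto simp: simple_graph_def component_of_def)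
  then have sub: "subgraph ?C G"
    using vC by (auto simp: subgraph_def component_of_def)
  have from_a: "(a, v) \<in> (adj ?C)\<^sup>*" if "(a, v) \<in> (adj G)\<^sup>*" for v
    using that
  proof (induction rule: rtrancl_induct)
    case (step y z)
    have "(a, z) \<in> (adj G)\<^sup>*" using step.hyps by auto
    then have "(y, z) \<in> adj ?C"
      using step.hyps by (auto simp: adj_def component_of_def)
    then show ?case using step.IH by auto
  qed auto
  have conn: "connected_graph ?C"
    unfolding connected_graph_iff
  proof (intro ballI)
    fix u v assume "u \<in> verts ?C" "v \<in> verts ?C"
    then have "(a, u) \<in> (adj ?C)\<^sup>*" "(a, v) \<in> (adj ?C)\<^sup>*"
      using from_a by (auto simp: component_of_def)
    then show "(u, v) \<in> (adj ?C)\<^sup>*"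
      using adj_rtrancl_sym rtrancl_trans by metis
  qed
  have "H = ?C" if H: "subgraph H G" "connected_graph H" "subgraph ?C H" for H
  proof -
    have aH: "a \<in> verts H" using H(3) aC by (auto simp: subgraph_def)
    have mono: "(adj H)\<^sup>* \<subseteq> (adj G)\<^sup>*"
      using H(1) by (intro rtrancl_mono adj_mono) (auto simp: subgraph_def)
    have v: "verts H \<subseteq> verts ?C"
      using H(2) aH mono by (auto simp: connected_graph_iff component_of_def)
    have e: "edges H \<subseteq> edges ?C"
    proof
      fix e assume e: "e \<in> edges H"
      then have "e \<subseteq> verts H" using H(1) by (auto simp: subgraph_def simple_graph_def)
      then show "e \<in> edges ?C"
        using v e H(1) by (auto simp: subgraph_def component_of_def)
    qed
    show ?thesis
      using v e H(3) by (intro graph.equality) (auto simp: subgraph_def)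
  qed
  then show ?thesis
    using sub conn by (simp add: component_def)
qed

section \<open>Existence of cycles\<close>

text \<open>All neighbours of the first vertex of a longest path lie on that path, so a second edge
  there closes a cycle.\<close>

lemma min_degree_2_has_cycle:
  assumes G: "simple_graph G" and deg: "\<And>v. v \<in> verts G \<Longrightarrow> degree G v \<ge> 2"
  shows "\<exists>C. is_cycle C \<and> subgraph C G"
proof -
  define Q where "Q p \<longleftrightarrow> p \<noteq> [] \<and> distinct p \<and> set p \<subseteq> verts G \<and>
      successively (\<lambda>x y. {x, y} \<in> edges G) p" for p
  have fin: "finite (verts G)" and ne: "verts G \<noteq> {}"
    using G by (auto simp: simple_graph_def)
  obtain a where "a \<in> verts G" using ne by blast
  then have "Q [a]" by (simp add: Q_def)
  have "\<forall>p. Q p \<longrightarrow> length p < Suc (card (verts G))"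
    using fin by (metis Q_def card_mono distinct_card less_Suc_eq_le)
  then obtain p where p: "Q p" and long: "\<And>q. Q q \<Longrightarrow> length q \<le> length p"
    using ex_has_greatest_nat[of Q "[a]" length] \<open>Q [a]\<close> by blast
  define u where "u = hd p"
  have p_nth0: "p ! 0 = u" using p by (auto simp: Q_def u_def hd_conv_nth)
  have uG: "u \<in> verts G" using p by (auto simp: Q_def u_def)
  have closed: "w \<in> set p" if "{u, w} \<in> edges G" for w
  proof (rule ccontr)
    assume "w \<notin> set p"
    moreover have "w \<in> verts G" using that G by (auto simp: simple_graph_def)
    ultimately have "Q (w # p)"
      using p that by (cases p) (auto simp: Q_def u_def insert_commute)
    then show False using long by fastforce
  qed
  \<comment> \<open>If \<open>p\<close> has one vertex, \<open>p ! 1\<close> is unspecified; the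
    count survives because the right-hand set is a singleton anyway.\<close>
  have "\<not> {e \<in> edges G. u \<in> e} \<subseteq> {{u, p ! 1}}"
  proof
    assume "{e \<in> edges G. u \<in> e} \<subseteq> {{u, p ! 1}}"
    then have "degree G u \<le> card {{u, p ! 1}}"
      unfolding degree_def by (intro card_mono) auto
    then show False using deg[OF uG] by simp
  qed
  then obtain e where e: "e \<in> edges G" "u \<in> e" "e \<noteq> {u, p ! 1}" by blast
  have "card e = 2" using G e by (auto simp: simple_graph_def)
  then obtain w where w: "e = {u, w}" "u \<noteq> w"
    using e(2) by (auto simp: card_2_iff doubleton_eq_iff)
  obtain j where j: "j < length p" "p ! j = w"
    using closed e w by (auto simp: in_set_conv_nth)
  have "j \<noteq> 0" "j \<noteq> 1" using w e j p_nth0 by auto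
  then have j2: "j \<ge> 2" by simp
  define vs where "vs = take (Suc j) p"
  have len: "length vs = Suc j" using j by (simp add: vs_def)
  define C where "C = \<lparr>verts = set vs,
    edges = {{vs ! i, vs ! (Suc i mod length vs)} | i. i < length vs}\<rparr>"
  have cyc: "is_cycle C"
    unfolding is_cycle_def using p j2 len
    by (intro exI[of _ vs]) (auto simp: C_def Q_def vs_def)
  have edge: "{vs ! i, vs ! (Suc i mod length vs)} \<in> edges G" if "i < length vs" for i
  proof (cases "i = j")
    case True
    then show ?thesis using len j e w p_nth0 by (simp add: vs_def insert_commute)
  next
    case False
    then have "{p ! i, p ! Suc i} \<in> edges G"
      using that len j p by (simp add: Q_def successively_conv_nth)
    then show ?thesis using False that len by (simp add: vs_def)
  qed
  have "set vs \<subseteq> verts G" using p set_take_subset[of "Suc j" p] by (auto simp: vs_def Q_def)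
  moreover have "e \<subseteq> set vs" if "e \<in> edges C" for e
    using that len by (auto simp: C_def)
  moreover have "edges C \<subseteq> edges G" using edge by (auto simp: C_def)
  moreover have "verts C = set vs" "set vs \<noteq> {}" using len by (auto simp: C_def)
  ultimately have "subgraph C G"
    using G unfolding subgraph_def simple_graph_def by auto
  then show ?thesis using cyc by blast
qed

lemma subgraph_trans: "subgraph A B \<Longrightarrow> subgraph B C \<Longrightarrow> subgraph A C"
  by (auto simp: subgraph_def)

lemma finite_edges: "simple_graph G \<Longrightarrow> finite (edges G)"
  by (rule finite_subset[of _ "Pow (verts G)"]) (auto simp: simple_graph_def)

text \<open>Deleting a vertex of degree at most 1 keeps at least as many edges as vertices; when no
  such vertex is left, the minimum degree is at least 2.\<close>

lemma has_cycle:
  assumes "simple_graph G" "card (edges G) \<ge> card (verts G)"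
  shows "\<exists>C. is_cycle C \<and> subgraph C G"
  using assms
proof (induction "card (verts G)" arbitrary: G rule: less_induct)
  case less
  show ?case
  proof (cases "\<exists>v\<in>verts G. degree G v \<le> 1")
    case False
    then show ?thesis
      by (intro min_degree_2_has_cycle less.prems) (auto simp: not_le Suc_le_eq numeral_2_eq_2)
  next
    case True
    then obtain v where v: "v \<in> verts G" "degree G v \<le> 1" by blast
    have fin: "finite (verts G)" and finE: "finite (edges G)"
      using less.prems finite_edges by (auto simp: simple_graph_def)
    define H where "H = \<lparr>verts = verts G - {v}, edges = edges G - {e \<in> edges G. v \<in> e}\<rparr>"
    have "card (edges H) = card (edges G) - degree G v"
      unfolding H_def degree_def using finE by (simp add: card_Diff_subset)
    then have cE: "card (edges H) \<ge> card (edges G) - 1" using v by linarith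
    have cV: "card (verts H) = card (verts G) - 1" using v fin by (simp add: H_def)
    have "verts H \<noteq> {}"
    proof
      assume "verts H = {}"
      then have V: "verts G = {v}" using v by (auto simp: H_def)
      have "edges G = {}"
      proof (rule ccontr)
        assume "edges G \<noteq> {}"
        then obtain e where "e \<subseteq> {v}" "card e = 2"
          using less.prems V by (auto simp: simple_graph_def)
        then show False using card_mono[of "{v}" e] by simp
      qed
      then show False using less.prems V by simp
    qed
    then have "subgraph H G"
      using less.prems fin by (auto simp: subgraph_def simple_graph_def H_def)
    moreover have "card (verts H) < card (verts G)"
      using cV v fin by (metis card_Diff1_less H_def graph.select_convs(1))
    moreover have "card (edges H) \<ge> card (verts H)" using cE cV less.prems by linarith
    ultimately show ?thesis
      using less.hyps[of H] subgraph_trans by (metis subgraph_def)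
  qed
qed

text \<open>A minimal vertex set spanning more edges than vertices is connected; removing an edge of
  one of its cycles leaves enough edges for a second cycle.\<close>

lemma pseudoforest_card_edges:
  assumes "pseudoforest G"
  shows "card (edges G) \<le> card (verts G)"
proof (rule ccontr)
  assume big: "\<not> ?thesis"
  have G: "simple_graph G" using assms by (simp add: pseudoforest_def)
  have finE: "finite (edges G)" using G by (rule finite_edges)
  have finV: "finite (verts G)" using G by (simp add: simple_graph_def)
  define EE where "EE W = {e \<in> edges G. e \<subseteq> W}" for W
  define Q where "Q W \<longleftrightarrow> W \<subseteq> verts G \<and> card (EE W) > card W" for W
  have "EE (verts G) = edges G" using G by (auto simp: EE_def simple_graph_def)
  then have "Q (verts G)" using big by (simp add: Q_def)
  then obtain W where W: "Q W" and min: "\<And>W'. Q W' \<Longrightarrow> card W \<le> card W'"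
    using ex_has_least_nat[of Q "verts G" card] by blast
  have finW: "finite W" using W finV finite_subset by (auto simp: Q_def)
  have fEE: "finite (EE U)" for U using finE by (simp add: EE_def)
  have "W \<noteq> {}"
  proof
    assume "W = {}"
    moreover have "EE {} = {}" using G by (auto simp: EE_def simple_graph_def)
    ultimately show False using W by (simp add: Q_def)
  qed
  then obtain a where a: "a \<in> W" by blast
  define H where "H = \<lparr>verts = W, edges = EE W\<rparr>"
  have H: "subgraph H G"
    using G W finW \<open>W \<noteq> {}\<close> by (auto simp: H_def subgraph_def simple_graph_def EE_def Q_def)
  define U where "U = {v. (a, v) \<in> (adj H)\<^sup>*}"
  have UW: "U \<subseteq> W" using reach_in_verts[of a _ H] a by (auto simp: U_def H_def)
  \<comment> \<open>Otherwise no edge joins \<open>U\<close> to \<open>W - U\<close>, and by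
    minimality neither set spans more edges than it has vertices.\<close>
  have "U = W"
  proof (rule ccontr)
    assume "U \<noteq> W"
    have "e \<subseteq> U \<or> e \<subseteq> W - U" if e: "e \<in> EE W" for e
    proof -
      have "card e = 2" using e G by (auto simp: EE_def simple_graph_def)
      then obtain x y where xy: "e = {x, y}" by (auto simp: card_2_iff)
      then have "(x, y) \<in> adj H" "(y, x) \<in> adj H"
        using e by (auto simp: adj_def H_def EE_def insert_commute)
      then have "x \<in> U \<longleftrightarrow> y \<in> U" unfolding U_def by (auto intro: rtrancl_into_rtrancl)
      then show ?thesis using xy e by (auto simp: EE_def)
    qed
    then have "EE W \<subseteq> EE U \<union> EE (W - U)" using UW by (auto simp: EE_def)
    then have "card (EE W) \<le> card (EE U) + card (EE (W - U))"
      by (meson card_Un_le card_mono fEE finite_UnI le_trans)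
    moreover have "card (EE Y) \<le> card Y" if "Y \<subset> W" for Y
      using min[of Y] psubset_card_mono[OF finW that] that W by (force simp: Q_def)
    moreover have "a \<in> U" by (simp add: U_def)
    moreover have "card U + card (W - U) = card W"
      using UW finW by (simp add: card_Diff_subset card_mono finite_subset)
    ultimately show False
      using W UW \<open>U \<noteq> W\<close> a by (smt (verit) Diff_subset Q_def add_le_mono le_trans
          linorder_not_le psubsetI Diff_iff)
  qed
  \<comment> \<open>\<open>pseudoforest\<close> speaks of components of \<open>G\<close>, so both
    cycles must be placed in one component; connectedness of \<open>W\<close> does this.\<close>
  then have reach: "W \<subseteq> verts (component_of G a)"
    using rtrancl_mono[OF adj_mono[of H G]] H
    by (auto simp: U_def component_of_def subgraph_def)
  have aG: "a \<in> verts G" using a W by (auto simp: Q_def)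
  let ?K = "component_of G a"
  have K: "component ?K G" using G aG by (rule component_component_of)
  have HK: "subgraph H ?K"
    using H reach by (auto simp: subgraph_def component_of_def H_def EE_def)
  obtain C where C: "is_cycle C" "subgraph C H"
    using has_cycle[of H] H W by (auto simp: subgraph_def H_def Q_def)
  obtain vs where vs: "length vs \<ge> 3"
    "edges C = {{vs ! i, vs ! (Suc i mod length vs)} | i. i < length vs}"
    using C by (auto simp: is_cycle_def)
  have "{vs ! 0, vs ! (Suc 0 mod length vs)} \<in> edges C" unfolding vs(2) using vs(1)
    by (intro CollectI exI[of _ 0]) auto
  then obtain e where e: "e \<in> edges C" by blast
  define H' where "H' = \<lparr>verts = W, edges = EE W - {e}\<rparr>"
  have H': "subgraph H' H"
    using H by (auto simp: subgraph_def H'_def H_def simple_graph_def)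
  have "e \<in> EE W" using e C by (auto simp: subgraph_def H_def)
  then have "card (edges H') \<ge> card (verts H')"
    using W fEE by (auto simp: H'_def Q_def)
  then obtain C' where C': "is_cycle C'" "subgraph C' H'"
    using has_cycle[of H'] H' by (auto simp: subgraph_def)
  have "C' \<noteq> C" using e C' by (auto simp: subgraph_def H'_def)
  moreover have "subgraph C ?K" "subgraph C' ?K"
    using C C' H' HK subgraph_trans by metis+
  ultimately show False
    using assms K C C' unfolding pseudoforest_def by blast
qed

subsection \<open>The tree and its path ends\<close>

text \<open>\<open>L\<close> will be \<open>l + 1\<close>, so that
  \<open>2 * l + 1 + \<alpha>\<close> reads \<open>2 * L - 1 + \<alpha>\<close>. The number
  \<open>N\<close> of branch vertices is the length of the chain.\<close>

locale caterpillar =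
  fixes k L \<alpha> N :: nat
  assumes k: "k \<ge> 1" and L: "L \<ge> 1" and \<alpha>: "\<alpha> \<le> 1" and N: "N \<ge> 1"
begin

text \<open>The tree is coded on \<open>{..<V}\<close> by a parent function. With \<open>y = z mod B\<close>, block \<open>i = z div B\<close>
  consists of a path \<open>T\<^sub>i\<close> of \<open>L\<close> vertices (\<open>y < L\<close>, top at \<open>y = 0\<close>), and, for \<open>i < N\<close>, of a branch vertex
  (\<open>y = L\<close>, joined to the tops of \<open>T\<^sub>i\<close> and \<open>T\<^sub>i\<^sub>+\<^sub>1\<close>) and \<open>k\<close> further paths of \<open>L\<close> vertices
  starting at \<open>y = L + \<alpha> + q * L\<close>, whose tops hang from the branch vertex. For \<open>\<alpha> = 0\<close> the branch
  vertex is itself the top of the first of these \<open>k\<close> paths.\<close>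

definition B :: nat where "B = (k + 1) * L + \<alpha>"

definition V :: nat where "V = N * B + L"

text \<open>As \<open>\<alpha>\<close> is at most 1, these are the branch vertices if
  \<open>\<alpha> = 1\<close>, and none if \<open>\<alpha> = 0\<close>, when a branch vertex counts
  as a path top.\<close>

definition spine :: "nat \<Rightarrow> bool" where
  "spine z \<longleftrightarrow> L \<le> z mod B \<and> z mod B < L + \<alpha>"

text \<open>Distance to the top of the own path. The hanging paths start at offsets congruent to
  \<open>\<alpha>\<close> modulo \<open>L\<close>, hence the shift. A spine vertex gets the default
  0.\<close>

definition hgt :: "nat \<Rightarrow> nat" where
  "hgt z = (let y = z mod B in if y < L then y else if y < L + \<alpha> then 0 else (y - \<alpha>) mod L)"

text \<open>The cases in order: top of a \<open>T\<^sub>i\<close>, branch vertex, top of a hanging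
  path, any other path vertex. At the root 0 the value is meaningless (truncated subtraction), so 0
  is treated apart.\<close>

definition par :: "nat \<Rightarrow> nat" where
  "par z = (let y = z mod B in
     if y = 0 then z - B + L else if y = L then z - L
     else if hgt z = 0 then z - y + L else z - 1)"

text \<open>A vertex \<open>z\<close> will be joined to \<open>k - spare z\<close> of the \<open>k\<close> hubs.\<close>

definition spare :: "nat \<Rightarrow> nat" where
  "spare z = (if z mod B = L then k
     else if z mod B = 0 \<and> 0 < z \<and> z < N * B then 1 else 0)"

lemma B_ge: "B \<ge> 2 * L"
  using k mult_le_mono1[of 2 "k + 1" L] unfolding B_def by linarith

lemma L_less_B: "L < B"
  using B_ge L by linarith

lemma B_pos: "0 < B"
  using L_less_B by simp

lemma mod_add_small: "z mod B + d < B \<Longrightarrow> (z + d) mod B = z mod B + d"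
  by (metis mod_add_left_eq mod_less)

lemma mod_diff_small: "d \<le> z mod B \<Longrightarrow> (z - d) mod B = z mod B - d"
proof -
  assume d: "d \<le> z mod B"
  have "z = z div B * B + z mod B" by simp
  then have "z - d = (z mod B - d) + z div B * B" using d by linarith
  then have "(z - d) mod B = (z mod B - d) mod B" by (metis mod_mult_self1)
  then show ?thesis by (metis B_pos less_imp_diff_less mod_less mod_less_divisor)
qed

text \<open>Guarantees that \<open>z - hgt z\<close>, the top of the path of \<open>z\<close>, is
  never a truncated difference.\<close>

lemma hgt_le: "hgt z \<le> z"
proof -
  have "(y - \<alpha>) mod L \<le> y" for y by (meson diff_le_self le_trans mod_less_eq_dividend)
  then have "hgt z \<le> z mod B" by (auto simp: hgt_def Let_def)
  then show ?thesis by (meson le_trans mod_less_eq_dividend)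
qed

lemma mod_zero_ge: "z mod B = 0 \<Longrightarrow> 0 < z \<Longrightarrow> B \<le> z"
  by (metis mod_less not_le gr_implies_not0)

lemma par_less: "0 < z \<Longrightarrow> par z < z"
proof -
  assume z: "0 < z"
  consider "z mod B = 0" | "z mod B = L" | "z mod B \<noteq> 0" "z mod B \<noteq> L" "hgt z = 0"
    | "z mod B \<noteq> 0" "z mod B \<noteq> L" "hgt z \<noteq> 0" by blast
  then show ?thesis
  proof cases
    case 1
    then show ?thesis using mod_zero_ge[OF _ z] L_less_B z by (simp add: par_def)
  next
    case 2
    then show ?thesis using L z by (simp add: par_def)
  next
    case 3
    then have "\<not> z mod B < L" by (auto simp: hgt_def Let_def)
    then have "L < z mod B" using 3 by simp
    moreover have "z mod B \<le> z" by simp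
    moreover have "par z = z - z mod B + L" using 3 by (simp add: par_def)
    ultimately show ?thesis by linarith
  next
    case 4
    then show ?thesis using z by (simp add: par_def)
  qed
qed

lemma hgt_mod_0: "z mod B = 0 \<Longrightarrow> hgt z = 0"
  using L by (simp add: hgt_def)

lemma hgt_mod_L: "z mod B = L \<Longrightarrow> hgt z = 0"
  using \<alpha> by (auto simp: hgt_def Let_def)

lemma spine_iff: "spine z \<longleftrightarrow> 0 < \<alpha> \<and> z mod B = L"
  using \<alpha> by (auto simp: spine_def)

text \<open>The potential argument needs only this distinction between edges joining path tops and
  branch vertices and edges inside a path, not the arithmetic of the coding.\<close>

lemma par_cases:
  assumes z: "0 < z"
  obtains (top) "hgt z = 0" "hgt (par z) = 0" "0 < \<alpha> \<Longrightarrow> spine z \<noteq> spine (par z)"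
  | (inner) "par z = z - 1" "hgt z = hgt (par z) + 1" "\<not> spine z" "\<not> spine (par z)"
proof -
  consider "z mod B = 0" | "z mod B = L" | "z mod B \<noteq> 0" "z mod B \<noteq> L" "hgt z = 0"
    | "z mod B \<noteq> 0" "z mod B \<noteq> L" "hgt z \<noteq> 0" by blast
  then show thesis
  proof cases
    case 1
    have "par z = z - B + L" using 1 by (simp add: par_def)
    moreover have "(z - B) mod B = 0" using 1 mod_zero_ge[OF 1 z] by (simp add: le_mod_geq)
    ultimately have "par z mod B = L" using mod_add_small[of "z - B" L] L_less_B by simp
    then show thesis using 1 top hgt_mod_0 hgt_mod_L L by (auto simp: spine_iff)
  next
    case 2
    have "par z = z - L" using 2 L by (simp add: par_def)
    then have "par z mod B = 0" using 2 mod_diff_small[of L z] by simp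
    then show thesis using 2 top hgt_mod_0 hgt_mod_L L by (auto simp: spine_iff)
  next
    case 3
    then have "\<not> z mod B < L" by (auto simp: hgt_def Let_def)
    then have y: "L < z mod B" using 3 by simp
    have "par z = z - (z mod B - L)" using 3 y by (simp add: par_def)
    then have "par z mod B = L" using mod_diff_small[of "z mod B - L" z] y by simp
    then show thesis using 3 top hgt_mod_L by (auto simp: spine_iff)
  next
    case 4
    have pz: "par z = z - 1" using 4 by (simp add: par_def)
    have pm: "par z mod B = z mod B - 1" unfolding pz using mod_diff_small[of 1 z] 4 by simp
    have ns: "\<not> spine z" using 4 by (simp add: spine_iff)
    \<comment> \<open>For \<open>\<alpha> = 1\<close> the successor of a branch vertex is a path
      top, so \<open>z\<close> would have height 0.\<close>
    have ns': "\<not> spine (par z)"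
    proof
      assume "spine (par z)"
      then have "\<alpha> = 1" "z mod B = L + 1" using pm 4 \<alpha> by (auto simp: spine_iff)
      then show False using 4(3) L unfolding hgt_def Let_def by auto
    qed
    have "hgt z = hgt (par z) + 1"
    proof (cases "z mod B < L")
      case True
      then show ?thesis using pm 4 by (simp add: hgt_def Let_def)
    next
      case False
      then have y: "z mod B > L" using 4 by simp
      then have y': "z mod B - 1 \<ge> L + \<alpha>"
        using ns' pm \<alpha> by (cases "\<alpha> = 0") (auto simp: spine_iff)
      then have h: "hgt z = (z mod B - \<alpha>) mod L" "hgt (par z) = (z mod B - 1 - \<alpha>) mod L"
        using pm by (auto simp: hgt_def Let_def)
      define x where "x = z mod B - 1 - \<alpha>"
      have "z mod B - \<alpha> = Suc x" using y' y by (simp add: x_def)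
      then have "hgt z = Suc x mod L" "hgt (par z) = x mod L" using h by (simp_all add: x_def)
      then show ?thesis using 4 by (metis Suc_eq_plus1 mod_Suc)
    qed
    then show thesis using pz ns ns' inner by blast
  qed
qed

text \<open>Two distinct path ends (the vertices of height \<open>L - 1\<close>) lie at distance at least
  \<open>2 * L - 1 + \<alpha>\<close>: the potential below changes by at most one along every edge.\<close>

definition potential :: "nat \<Rightarrow> nat \<Rightarrow> nat \<Rightarrow> int" where
  "potential u v z =
     (if \<not> spine z \<and> z - hgt z = u - hgt u then int L - 1 - int (hgt z)
      else if \<not> spine z \<and> z - hgt z = v - hgt v then int L + int \<alpha> + int (hgt z)
      else int L)"

definition path_ends :: "nat set" where
  "path_ends = {z. z < V \<and> \<not> spine z \<and> hgt z = L - 1}"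

lemma potential_left: "u \<in> path_ends \<Longrightarrow> potential u v u = 0"
  using L by (simp add: potential_def path_ends_def of_nat_diff)

lemma potential_right:
  assumes "u \<in> path_ends" "v \<in> path_ends" "u \<noteq> v"
  shows "potential u v v = 2 * int L - 1 + int \<alpha>"
proof -
  \<comment> \<open>Both ends have height \<open>L - 1\<close>, so a common top would make them
    equal.\<close>
  have "v - hgt v \<noteq> u - hgt u"
    using assms hgt_le[of u] hgt_le[of v] unfolding path_ends_def by auto
  then show ?thesis
    using assms L by (simp add: potential_def path_ends_def of_nat_diff)
qed

text \<open>For \<open>\<alpha> = 0\<close>, vertices of height 0 have value \<open>L - 1\<close> or
  \<open>L\<close>. For \<open>\<alpha> = 1\<close>, also \<open>L + 1\<close> occurs, but an edge
  between vertices of height 0 has one end on the spine, where the value is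
  \<open>L\<close>.\<close>

lemma potential_lipschitz:
  assumes "0 < z"
  shows "\<bar>potential u v z - potential u v (par z)\<bar> \<le> 1"
  using assms
proof (cases rule: par_cases)
  case top
  have "potential u v x \<in> {int L - 1, int L, int L + int \<alpha>} \<and>
      (spine x \<longrightarrow> potential u v x = int L)" if "hgt x = 0" for x
    unfolding potential_def that by simp
  from this[of z] this[of "par z"] show ?thesis using top \<alpha> by (cases "\<alpha> = 0") auto
next
  case inner
  then have same: "z - hgt z = par z - hgt (par z)" by simp
  show ?thesis unfolding potential_def same using inner(2-4) by simp
qed

section \<open>Counting path ends and spares\<close>

lemma path_end_first: "i * B + (L - 1) < V \<Longrightarrow> i * B + (L - 1) \<in> path_ends"
proof -
  assume *: "i * B + (L - 1) < V"
  have "(i * B + (L - 1)) mod B = L - 1" using L_less_B by simp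
  then show ?thesis using * L unfolding path_ends_def spine_def hgt_def Let_def by auto
qed

text \<open>Here \<open>q\<close> starts at 1: the hanging path begins at offset
  \<open>\<alpha> + q * L\<close>.\<close>

lemma path_end_other:
  assumes "i < N" "1 \<le> q" "q \<le> k"
  shows "i * B + (\<alpha> + q * L + (L - 1)) \<in> path_ends" "\<alpha> + q * L + (L - 1) < B"
proof -
  let ?y = "\<alpha> + q * L + (L - 1)"
  have "q * L + L \<le> (k + 1) * L" using mult_le_mono1[of "q + 1" "k + 1" L] assms by simp
  then show y: "?y < B" using L unfolding B_def by linarith
  have "(i + 1) * B \<le> N * B" using assms by (intro mult_le_mono1) simp
  then have V: "i * B + ?y < V" using y by (simp add: V_def)
  have m: "(i * B + ?y) mod B = ?y" using y by simp
  have qL: "q * L \<ge> L" using assms by simp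
  have ge: "\<not> ?y < L + \<alpha>" using qL L \<alpha> by linarith
  have ns: "\<not> spine (i * B + ?y)" using m ge by (simp add: spine_def)
  have "?y - \<alpha> = L - 1 + q * L" by simp
  then have "(?y - \<alpha>) mod L = (L - 1) mod L" by (metis mod_mult_self1)
  then have "hgt (i * B + ?y) = L - 1"
    using m L ge unfolding hgt_def Let_def by auto
  then show "i * B + ?y \<in> path_ends" using V ns by (simp add: path_ends_def)
qed

text \<open>Each of the \<open>N\<close> blocks has the end of its \<open>T\<^sub>i\<close> and
  \<open>k\<close> hanging ends; the final path adds one. Offsets stay below \<open>B\<close>, so
  division by \<open>B\<close> recovers the block.\<close>

lemma card_path_ends: "(k + 1) * N + 1 \<le> card path_ends"
proof -
  define f where "f q = (if q = 0 then L - 1 else \<alpha> + q * L + (L - 1))" for q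
  define g where "g x = (case x of (i, q) \<Rightarrow> i * B + f q)" for x :: "nat \<times> nat"
  define D where "D = {..<N} \<times> {..k} \<union> {(N, 0)}"
  have fB: "f q < B" if "q \<le> k" for q
    using path_end_other(2)[of 0 q] that N L_less_B by (auto simp: f_def)
  have "strict_mono f"
    unfolding strict_mono_Suc_iff using L by (auto simp: f_def)
  then have inj: "inj f" by (rule strict_mono_imp_inj_on)
  have "inj_on g D"
  proof (rule inj_onI)
    fix x y assume xy: "x \<in> D" "y \<in> D" "g x = g y"
    obtain i q j r where [simp]: "x = (i, q)" "y = (j, r)" by (cases x, cases y)
    have qr: "q \<le> k" "r \<le> k" using xy by (auto simp: D_def)
    have eq: "i * B + f q = j * B + f r" using xy by (simp add: g_def)
    have "i = (i * B + f q) div B" "j = (j * B + f r) div B" using fB qr B_pos by simp_all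
    then have "i = j" using eq by simp
    then have "f q = f r" using eq by simp
    then show "x = y" using inj \<open>i = j\<close> by (simp add: inj_eq)
  qed
  moreover have "g ` D \<subseteq> path_ends"
  proof
    fix z assume "z \<in> g ` D"
    then obtain i q where iq: "(i, q) \<in> D" "z = i * B + f q" by (auto simp: g_def)
    show "z \<in> path_ends"
    proof (cases "q = 0")
      case True
      have "i * B \<le> N * B" using iq by (intro mult_le_mono1) (auto simp: D_def)
      then have "i * B + (L - 1) < V" using L unfolding V_def by linarith
      then show ?thesis using iq True path_end_first by (simp add: f_def)
    next
      case False
      then show ?thesis using iq path_end_other(1)[of i q] by (auto simp: D_def f_def)
    qed
  qed
  moreover have "finite path_ends" by (simp add: path_ends_def)
  ultimately have "card D \<le> card path_ends" by (rule card_inj_on_le)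
  moreover have "card D = (k + 1) * N + 1"
    unfolding D_def by (subst card_Un_disjoint) (auto simp: card_cartesian_product)
  ultimately show ?thesis by simp
qed

lemma spare_le: "spare z \<le> k"
  using k by (simp add: spare_def)

text \<open>Each branch vertex has \<open>k\<close> units and each \<open>T\<^sub>i\<close> except
  the first and the last has one: \<open>k * N + (N - 1)\<close>.\<close>

lemma sum_spare: "(\<Sum>z<V. spare z) = (k + 1) * N - 1"
proof -
  have V: "{..<V} = {..<N * B} \<union> {N * B..<N * B + L}" by (auto simp: V_def)
  have last: "(\<Sum>z=N * B..<N * B + L. spare z) = 0"
  proof (intro sum.neutral ballI)
    fix z assume "z \<in> {N * B..<N * B + L}"
    then obtain y where y: "z = N * B + y" "y < L" by (metis atLeastLessThan_iff le_Suc_ex add_less_cancel_left)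
    then have "z mod B = y" using L_less_B by simp
    then show "spare z = 0" using y by (auto simp: spare_def)
  qed
  have blk: "(\<Sum>z=i * B..<i * B + B. spare z) = (if i = 0 then k else k + 1)" if "i < N" for i
  proof -
    have "i * B < N * B" using that B_pos by simp
    have "(\<Sum>z=i * B..<i * B + B. spare z) = (\<Sum>y<B. spare (i * B + y))"
      using sum.shift_bounds_nat_ivl[of spare 0 "i * B" B] by (simp add: add.commute lessThan_atLeast0)
    also have "\<dots> = (\<Sum>y<B. (if y = L then k else 0) + (if y = 0 then (if i = 0 then 0 else 1) else 0))"
      using \<open>i * B < N * B\<close> L B_pos by (intro sum.cong) (auto simp: spare_def)
    also have "\<dots> = (if i = 0 then k else k + 1)"
      using L_less_B B_pos by (simp add: sum.distrib)
    finally show ?thesis .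
  qed
  have "(\<Sum>z<N * B. spare z) = (\<Sum>i<N. \<Sum>z=i * B..<i * B + B. spare z)"
    by (rule sum.nat_group[symmetric])
  also have "\<dots> = (\<Sum>i<N. if i = 0 then k else k + 1)" using blk by simp
  also have "\<dots> = (k + 1) * N - 1"
  proof -
    obtain n where n: "N = Suc n" using N by (cases N) auto
    show ?thesis unfolding n by (subst sum.lessThan_Suc_shift) (simp add: algebra_simps)
  qed
  finally have "(\<Sum>z<N * B. spare z) = (k + 1) * N - 1" .
  then show ?thesis
    unfolding V by (subst sum.union_disjoint) (auto simp: last)
qed

text \<open>The margin is 2 because a tree on \<open>V\<close> vertices has only
  \<open>V - 1\<close> edges: separating all path ends then deletes at least one edge more than the
  total \<open>spare\<close>.\<close>

lemma sum_spare_path_ends: "(\<Sum>z<V. spare z) + 2 \<le> card path_ends"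
  using card_path_ends sum_spare N k by (simp add: algebra_simps)

subsection \<open>Density of the tree\<close>

text \<open>A full block carries \<open>k + 1\<close> spare units on \<open>B\<close> vertices. The
  required density is \<open>k + 1 - rate\<close>.\<close>

definition rate :: real where "rate = real (k + 1) / real B"

text \<open>\<open>full_spare\<close> differs from \<open>spare\<close> only at \<open>N * B\<close>; this makes the induction over the blocks
  uniform.\<close>

definition full_spare :: "nat \<Rightarrow> nat" where
  "full_spare z = (if z mod B = L then k else if z mod B = 0 \<and> 0 < z then 1 else 0)"

definition is_root :: "nat set \<Rightarrow> nat \<Rightarrow> bool" where
  "is_root X z \<longleftrightarrow> z = 0 \<or> par z \<notin> X"

text \<open>Summed over \<open>X\<close>, this is the number of tree components that
  \<open>X\<close> induces plus the spares minus \<open>rate * card X\<close>. The value 0 outside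
  \<open>X\<close> allows sums over whole intervals.\<close>

definition excess :: "nat set \<Rightarrow> nat \<Rightarrow> real" where
  "excess X z =
     (if z \<in> X then of_bool (is_root X z) + real (full_spare z) - rate else 0)"

lemma rate_pos: "0 < rate"
  using B_pos by (simp add: rate_def)

lemma rate_B: "rate * real B = real k + 1"
  using B_pos by (simp add: rate_def)

lemma rate_L: "rate * real L \<le> 1"
proof -
  have "(k + 1) * L \<le> B" by (simp add: B_def)
  then have "real (k + 1) * real L \<le> real B" by (metis of_nat_le_iff of_nat_mult)
  then show ?thesis using B_pos by (simp add: rate_def field_simps)
qed

lemma excess_ge: "excess X z \<ge> - rate"
  using rate_pos by (simp add: excess_def)

lemma sum_excess_ge:
  assumes "finite S" "r \<in> S"
  shows "(\<Sum>z\<in>S. excess X z) \<ge> excess X r + rate - rate * real (card S)"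
proof -
  have "(\<Sum>z\<in>S. excess X z) = excess X r + (\<Sum>z\<in>S - {r}. excess X z)"
    using assms by (simp add: sum.remove)
  moreover have "(\<Sum>z\<in>S - {r}. excess X z) \<ge> (\<Sum>z\<in>S - {r}. - rate)"
    by (intro sum_mono excess_ge)
  moreover have "real (card (S - {r})) = real (card S) - 1"
    using assms by (metis card_Suc_Diff1 of_nat_Suc add_diff_cancel_left')
  ultimately show ?thesis by (simp add: algebra_simps)
qed

text \<open>The least selected vertex is a root and gains 1, while \<open>L\<close> vertices cost at
  most \<open>rate * L\<close>, which is at most 1.\<close>

lemma sum_excess_path_nonneg:
  assumes top: "a \<in> X \<Longrightarrow> is_root X a"
    and step: "\<And>z. a < z \<Longrightarrow> z < a + L \<Longrightarrow> par z = z - 1"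
  shows "(\<Sum>z=a..<a + L. excess X z) \<ge> 0"
proof (cases "X \<inter> {a..<a + L} = {}")
  case True
  then show ?thesis by (intro sum_nonneg) (auto simp: excess_def)
next
  case False
  define r where "r = (LEAST z. z \<in> X \<inter> {a..<a + L})"
  have r: "r \<in> X \<inter> {a..<a + L}" unfolding r_def using False by (metis LeastI ex_in_conv)
  have "is_root X r"
  proof (cases "r = a")
    case True
    then show ?thesis using top r by simp
  next
    case False
    then have "par r = r - 1" using r step by auto
    moreover have "r - 1 \<notin> X"
      using not_less_Least[of "r - 1" "\<lambda>z. z \<in> X \<inter> {a..<a + L}"] r False unfolding r_def[symmetric]
      by auto
    ultimately show ?thesis by (simp add: is_root_def)
  qed
  then have "excess X r \<ge> 1 - rate" using r by (simp add: excess_def)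
  moreover have "(\<Sum>z=a..<a + L. excess X z) \<ge> excess X r + rate - rate * real L"
    using sum_excess_ge[of "{a..<a + L}" r X] r by simp
  ultimately show ?thesis using rate_L by linarith
qed

section \<open>Excess of a single block\<close>

lemma par_first_path: "0 < y \<Longrightarrow> y < L \<Longrightarrow> par (i * B + y) = i * B + y - 1"
  using L_less_B by (simp add: par_def hgt_def Let_def)

text \<open>For \<open>\<alpha> = 0\<close>, \<open>q = 0\<close>, \<open>h = 0\<close> the vertex
  is the branch vertex itself, which hangs from \<open>i * B\<close>.\<close>

lemma par_other_path:
  assumes "q < k" "h < L"
  shows "par (i * B + (L + \<alpha> + q * L + h)) =
    (if h = 0 \<and> 0 < \<alpha> + q then i * B + L else if h = 0 then i * B
     else i * B + (L + \<alpha> + q * L + h) - 1)"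
proof -
  let ?y = "L + \<alpha> + q * L + h"
  have "q * L + L \<le> k * L" using mult_le_mono1[of "q + 1" k L] assms by simp
  then have "?y < B" using assms by (simp add: B_def)
  then have m: "(i * B + ?y) mod B = ?y" by simp
  have "(?y - \<alpha>) = h + (q + 1) * L" by simp
  then have "(?y - \<alpha>) mod L = h" using assms by (metis mod_mult_self1 mod_less)
  then have hg: "hgt (i * B + ?y) = h" unfolding hgt_def m Let_def by simp
  have "?y = L \<longleftrightarrow> \<alpha> = 0 \<and> q = 0 \<and> h = 0" using L by auto
  then show ?thesis using L unfolding par_def m hg Let_def by auto
qed

lemma par_spine: "par (i * B + L) = i * B"
  using L_less_B L by (simp add: par_def)

lemma par_block: "par (Suc i * B) = i * B + L"
  using B_pos by (simp add: par_def)

lemma first_path_excess: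
  "(\<Sum>z=i * B..<i * B + L. excess X z) \<ge>
     (if i * B \<in> X
      then of_bool (is_root X (i * B)) + of_bool (0 < i) - rate * real L else 0)"
proof (cases "i * B \<in> X")
  case False
  have "par z = z - 1" if "i * B < z" "z < i * B + L" for z
    using par_first_path[of "z - i * B" i] that by simp
  then show ?thesis
    using sum_excess_path_nonneg[of "i * B" X] False by simp
next
  case True
  have "full_spare (i * B) = of_bool (0 < i)" using B_pos L by (simp add: full_spare_def)
  then have "excess X (i * B) = of_bool (is_root X (i * B)) + of_bool (0 < i) - rate"
    using True by (simp add: excess_def)
  then show ?thesis
    using True sum_excess_ge[of "{i * B..<i * B + L}" "i * B" X] L by simp
qed

text \<open>A selected branch vertex brings \<open>k\<close>, and the \<open>B - L\<close> vertices
  cost at most \<open>k + 1 - rate * L\<close>. If it is not selected, the tops of the hanging paths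
  are roots when selected, and each path is nonnegative.\<close>

lemma branch_excess:
  "(\<Sum>z=i * B + L..<i * B + B. excess X z) \<ge>
     (if i * B + L \<in> X then of_bool (i * B \<notin> X) + rate * real L - 1 else 0)"
proof (cases "i * B + L \<in> X")
  case True
  have "full_spare (i * B + L) = k" using L_less_B by (simp add: full_spare_def)
  then have "excess X (i * B + L) \<ge> of_bool (i * B \<notin> X) + real k - rate"
    using True L by (simp add: excess_def is_root_def par_spine)
  moreover have "real (card {i * B + L..<i * B + B}) = real B - real L"
    using L_less_B by (simp add: of_nat_diff)
  ultimately show ?thesis
    using True sum_excess_ge[of "{i * B + L..<i * B + B}" "i * B + L" X] rate_B L_less_B
    by (simp add: algebra_simps)
next
  case False
  define a where "a q = i * B + (L + \<alpha> + q * L)" for q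
  have path: "(\<Sum>z=a q..<a q + L. excess X z) \<ge> 0" if q: "q < k" for q
  proof (rule sum_excess_path_nonneg)
    assume aX: "a q \<in> X"
    have "0 < \<alpha> + q" using aX False by (cases "\<alpha> + q = 0") (auto simp: a_def)
    then have "par (a q) = i * B + L" using par_other_path[of q 0 i] q L by (simp add: a_def)
    then show "is_root X (a q)" using False by (simp add: is_root_def)
  next
    fix z assume z: "a q < z" "z < a q + L"
    then obtain h where h: "z = a q + h" "0 < h" "h < L"
      by (metis add_less_cancel_left less_imp_add_positive)
    then show "par z = z - 1" using par_other_path[of q h i] q by (simp add: a_def add.assoc)
  qed
  have split: "{i * B + L..<i * B + B} = {i * B + L..<i * B + L + \<alpha>} \<union> {a 0..<a 0 + k * L}"
    by (auto simp: a_def B_def)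
  have "(\<Sum>z=i * B + L..<i * B + L + \<alpha>. excess X z) = 0"
  proof (intro sum.neutral ballI)
    fix z assume "z \<in> {i * B + L..<i * B + L + \<alpha>}"
    then have "z = i * B + L" using \<alpha> by auto
    then show "excess X z = 0" using False by (simp add: excess_def)
  qed
  moreover have "(\<Sum>z=a 0..<a 0 + k * L. excess X z) \<ge> 0"
  proof -
    have "(\<Sum>z=a 0..<a 0 + k * L. excess X z) = (\<Sum>z<k * L. excess X (z + a 0))"
      using sum.shift_bounds_nat_ivl[of "excess X" 0 "a 0" "k * L"]
      by (simp add: add.commute lessThan_atLeast0)
    also have "\<dots> = (\<Sum>q<k. \<Sum>z=q * L..<q * L + L. excess X (z + a 0))"
      by (rule sum.nat_group[symmetric])
    also have "\<dots> = (\<Sum>q<k. \<Sum>z=a q..<a q + L. excess X z)"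
    proof (rule sum.cong[OF refl])
      fix q
      have "(\<Sum>z=q * L..<q * L + L. excess X (z + a 0)) = (\<Sum>z=q * L + a 0..<q * L + L + a 0. excess X z)"
        by (rule sum.shift_bounds_nat_ivl[symmetric])
      then show "(\<Sum>z=q * L..<q * L + L. excess X (z + a 0)) = (\<Sum>z=a q..<a q + L. excess X z)"
        by (simp add: a_def algebra_simps)
    qed
    also have "\<dots> \<ge> 0" by (rule sum_nonneg) (use path in simp)
    finally show ?thesis .
  qed
  ultimately show ?thesis
    unfolding split using False by (subst sum.union_disjoint) (auto simp: a_def)
qed

text \<open>With \<open>p = rate * L \<le> 1\<close>, a selected top of some \<open>T\<^sub>i\<close> contributes \<open>2 - p\<close>, a selected branch
  vertex \<open>p\<close>, and every edge between them costs 1. Only a run from \<open>T\<^sub>0\<close> on, whose first top has no spare, can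
  stay below 1 at a selected top.\<close>

lemma sum_excess_prefix:
  "(i * B \<in> X \<longrightarrow> (\<Sum>z<i * B + L. excess X z) \<ge> 1 \<or>
      ((\<Sum>z<i * B + L. excess X z) \<ge> 1 - rate * real L \<and> (\<forall>j\<le>i. j * B \<in> X))) \<and>
   (i * B \<notin> X \<longrightarrow> (\<Sum>z<i * B + L. excess X z) \<ge> 0)"
proof (induction i)
  case 0
  show ?case using first_path_excess[of 0 X] by (auto simp: is_root_def lessThan_atLeast0)
next
  case (Suc i)
  define s where "s = (\<Sum>z<i * B + L. excess X z)"
  define h where "h = (\<Sum>z=i * B + L..<i * B + B. excess X z)"
  define t where "t = (\<Sum>z=Suc i * B..<Suc i * B + L. excess X z)"
  define p where "p = rate * real L"
  have Suc_i: "Suc i * B = i * B + B" by simp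
  have "s + h = (\<Sum>z=0..<i * B + B. excess X z)"
    unfolding s_def h_def lessThan_atLeast0 using L_less_B
    by (intro sum.atLeastLessThan_concat) auto
  then have sum: "(\<Sum>z<Suc i * B + L. excess X z) = s + h + t"
    unfolding t_def lessThan_atLeast0 Suc_i
    by (simp add: sum.atLeastLessThan_concat)
  have h: "h \<ge> (if i * B + L \<in> X then of_bool (i * B \<notin> X) + p - 1 else 0)"
    unfolding h_def p_def by (rule branch_excess)
  have "is_root X (Suc i * B) \<longleftrightarrow> i * B + L \<notin> X"
    using B_pos by (simp add: is_root_def par_block del: mult_Suc)
  then have t: "t \<ge> (if Suc i * B \<in> X then of_bool (i * B + L \<notin> X) + 1 - p else 0)"
    unfolding t_def p_def using first_path_excess[of "Suc i" X]
    by (auto simp del: mult_Suc split: if_splits)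
  have p: "0 \<le> p" "p \<le> 1" using rate_pos rate_L by (simp_all add: p_def)
  have all: "(\<forall>j\<le>Suc i. j * B \<in> X) \<longleftrightarrow> (\<forall>j\<le>i. j * B \<in> X) \<and> Suc i * B \<in> X"
    by (simp add: le_Suc_eq del: mult_Suc) blast
  note IH = Suc.IH[folded s_def p_def]
  \<comment> \<open>If both tops and the branch vertex between them are selected,
    \<open>p - 1\<close> and \<open>1 - p\<close> cancel and the bound is handed on; every other
    case with the new top selected gives at least 1. A run stopping at the branch vertex keeps at
    least \<open>(1 - p) + (p - 1) = 0\<close>.\<close>
  show ?case
    unfolding sum all p_def[symmetric]
    by (cases "i * B \<in> X"; cases "i * B + L \<in> X"; cases "Suc i * B \<in> X";
        insert IH h t p; auto simp del: mult_Suc)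
qed

text \<open>\<open>full_spare\<close> counts one unit too many at \<open>N * B\<close>. The prefix
  bound supplies it unless all \<open>N + 1\<close> vertices \<open>j * B\<close> are selected; then
  \<open>\<epsilon> * card X\<close> is at least 1 and pays for it.\<close>

lemma density:
  assumes X: "X \<subseteq> {..<V}" and \<epsilon>: "\<epsilon> * (real N + 1) \<ge> 1" "\<epsilon> > 0"
  shows "rate * real (card X) \<le>
    real (card {z \<in> X. is_root X z}) + real (\<Sum>z\<in>X. spare z) + \<epsilon> * real (card X)"
proof -
  have fin: "finite X" using X finite_subset by blast
  have "N * B < V" using L by (simp add: V_def)
  define e where "e = (\<Sum>z<V. excess X z)"
  have "e = (\<Sum>z\<in>X. of_bool (is_root X z) + real (full_spare z) - rate)"
    unfolding e_def using X by (intro sum.mono_neutral_cong_right) (auto simp: excess_def)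
  also have "\<dots> = real (card {z \<in> X. is_root X z}) + real (\<Sum>z\<in>X. full_spare z) - rate * real (card X)"
    using fin by (simp add: sum.distrib sum_subtractf sum.If_cases of_bool_def Int_def)
  finally have e: "e = real (card {z \<in> X. is_root X z}) + real (\<Sum>z\<in>X. full_spare z)
      - rate * real (card X)" .
  have "full_spare z = spare z + of_bool (z = N * B)" if "z < V" for z
  proof -
    have "z = N * B" if z: "z mod B = 0" "N * B \<le> z"
    proof -
      obtain y where y: "z = N * B + y" using z(2) le_Suc_ex by blast
      then have "y < B" using \<open>z < V\<close> L_less_B by (simp add: V_def)
      then show ?thesis using z(1) y by simp
    qed
    moreover have "0 < N * B" "(N * B) mod B = 0" using N B_pos by auto
    ultimately show ?thesis using L by (auto simp: full_spare_def spare_def)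
  qed
  then have "(\<Sum>z\<in>X. full_spare z) = (\<Sum>z\<in>X. spare z + of_bool (z = N * B))"
    using X by (intro sum.cong) auto
  also have "\<dots> = (\<Sum>z\<in>X. spare z) + of_bool (N * B \<in> X)"
    using fin by (simp add: sum.distrib of_bool_def)
  finally have sp: "real (\<Sum>z\<in>X. full_spare z) = real (\<Sum>z\<in>X. spare z) + of_bool (N * B \<in> X)"
    by simp
  have "e \<ge> of_bool (N * B \<in> X) - \<epsilon> * real (card X)"
  proof (cases "\<forall>j\<le>N. j * B \<in> X")
    case False
    then have "e \<ge> of_bool (N * B \<in> X)"
      using sum_excess_prefix[of N X] unfolding e_def V_def by auto
    moreover have "0 \<le> \<epsilon> * real (card X)" using \<epsilon> by simp
    ultimately show ?thesis by linarith
  next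
    case True
    then have "(\<lambda>j. j * B) ` {..N} \<subseteq> X" by auto
    then have "card ((\<lambda>j. j * B) ` {..N}) \<le> card X" using fin card_mono by blast
    moreover have "inj_on (\<lambda>j. j * B) {..N}" using B_pos by (auto simp: inj_on_def)
    ultimately have "N + 1 \<le> card X" by (simp add: card_image)
    then have "\<epsilon> * (real N + 1) \<le> \<epsilon> * real (card X)"
      using \<epsilon> by (intro mult_left_mono) auto
    then have "1 \<le> \<epsilon> * real (card X)" using \<epsilon> by linarith
    moreover have "e \<ge> 0"
      using sum_excess_prefix[of N X] True rate_L unfolding e_def V_def by auto
    ultimately show ?thesis using True by simp
  qed
  then show ?thesis using e sp by linarith
qed

end

subsection \<open>Copies of the tree joined to the hubs\<close>

lemma lipschitz_walk:
  fixes \<psi> :: "'a \<Rightarrow> int"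
  assumes "successively (\<lambda>x y. {x, y} \<in> E) p" "p \<noteq> []"
    and "\<And>x y. {x, y} \<in> E \<Longrightarrow> \<bar>\<psi> x - \<psi> y\<bar> \<le> 1"
  shows "\<psi> (last p) - \<psi> (hd p) \<le> int (length p) - 1"
  using assms
proof (induction p)
  case (Cons a p)
  show ?case
  proof (cases p)
    case (Cons b q)
    then have "\<psi> (last p) - \<psi> (hd p) \<le> int (length p) - 1" "\<bar>\<psi> a - \<psi> b\<bar> \<le> 1"
      using Cons.IH Cons.prems by auto
    then show ?thesis using Cons by auto
  qed simp
qed simp

text \<open>\<open>length p\<close> counts vertices, so the assumption says that every walk has at
  least \<open>d\<close> edges. Connectedness makes the \<open>LEAST\<close> in
  \<open>distance\<close> attained.\<close>

lemma le_graph_diameter: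
  assumes C: "simple_graph C" "connected_graph C" and uv: "u \<in> verts C" "v \<in> verts C"
    and walk: "\<And>p. walk_betw C u p v \<Longrightarrow> d < length p"
  shows "d \<le> graph_diameter C"
proof -
  obtain p where p: "walk_betw C u p v" using C uv by (auto simp: connected_graph_def)
  then obtain n where "length p = Suc n" by (cases p) (auto simp: walk_betw_def)
  then have "\<exists>q. walk_betw C u q v \<and> length q = Suc n" using p by blast
  then have "\<exists>q. walk_betw C u q v \<and> length q = Suc (distance C u v)"
    unfolding distance_def by (rule LeastI)
  then have "d \<le> distance C u v" using walk by fastforce
  moreover have "finite ((\<lambda>(u, v). distance C u v) ` (verts C \<times> verts C))"
    using C by (simp add: simple_graph_def)
  then have "finite {distance C u v | u v. u \<in> verts C \<and> v \<in> verts C}"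
    by (rule rev_finite_subset) auto
  then have "distance C u v \<le> graph_diameter C"
    unfolding graph_diameter_def using uv by (intro Max_ge) auto
  ultimately show ?thesis by simp
qed

text \<open>A number \<open>x < M * V\<close> is vertex \<open>x mod V\<close> of copy
  \<open>x div V\<close>; the hubs are \<open>M * V + j\<close> with \<open>j < k\<close>.\<close>

locale caterpillars = caterpillar +
  fixes M :: nat
begin

definition gpar :: "nat \<Rightarrow> nat" where
  "gpar x = x div V * V + par (x mod V)"

definition tree_edge :: "nat \<Rightarrow> nat set" where
  "tree_edge x = {x, gpar x}"

definition nonroots :: "nat set" where
  "nonroots = {x. x < M * V \<and> x mod V \<noteq> 0}"

definition hub_edge :: "nat \<times> nat \<Rightarrow> nat set" where
  "hub_edge p = {fst p, M * V + snd p}"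

definition hub_pairs :: "(nat \<times> nat) set" where
  "hub_pairs = (SIGMA x:{..<M * V}. {..<k - spare (x mod V)})"

definition G :: "nat graph" where
  "G = \<lparr>verts = {..<M * V + k}, edges = tree_edge ` nonroots \<union> hub_edge ` hub_pairs\<rparr>"

lemma V_pos: "0 < V"
  using L by (simp add: V_def)

lemma par_less_V: "0 < z \<Longrightarrow> z < V \<Longrightarrow> par z < V"
  using par_less by (meson less_trans)

lemma gpar_less: "x mod V \<noteq> 0 \<Longrightarrow> gpar x < x"
  using par_less[of "x mod V"] div_mult_mod_eq[of x V] unfolding gpar_def by linarith

lemma gpar_div_mod:
  assumes "x mod V \<noteq> 0"
  shows "gpar x div V = x div V" "gpar x mod V = par (x mod V)"
  using par_less_V[of "x mod V"] assms V_pos by (simp_all add: gpar_def)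

lemma copy_less: "c < M \<Longrightarrow> z < V \<Longrightarrow> c * V + z < M * V"
proof -
  assume "c < M" "z < V"
  moreover have "(c + 1) * V \<le> M * V" using \<open>c < M\<close> by (intro mult_le_mono1) simp
  ultimately show ?thesis by simp
qed

lemma div_less_M: "x < M * V \<Longrightarrow> x div V < M"
  by (simp add: less_mult_imp_div_less)

lemma sum_copies:
  fixes f :: "nat \<Rightarrow> 'b :: comm_monoid_add"
  shows "(\<Sum>x<M * V. f x) = (\<Sum>c<M. \<Sum>z<V. f (c * V + z))"
proof -
  have "(\<Sum>x<M * V. f x) = (\<Sum>c<M. \<Sum>x=c * V..<c * V + V. f x)"
    by (rule sum.nat_group[symmetric])
  also have "\<dots> = (\<Sum>c<M. \<Sum>z<V. f (c * V + z))"
  proof (rule sum.cong[OF refl])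
    fix c
    show "(\<Sum>x=c * V..<c * V + V. f x) = (\<Sum>z<V. f (c * V + z))"
      using sum.shift_bounds_nat_ivl[of f 0 "c * V" V]
      by (simp add: add.commute lessThan_atLeast0)
  qed
  finally show ?thesis .
qed

lemma inj_tree_edge: "inj_on tree_edge nonroots"
proof (rule inj_onI)
  fix x y assume "x \<in> nonroots" "y \<in> nonroots" and eq: "tree_edge x = tree_edge y"
  then have "gpar x < x" "gpar y < y" using gpar_less by (auto simp: nonroots_def)
  then show "x = y" using eq by (auto simp: tree_edge_def doubleton_eq_iff)
qed

lemma inj_hub_edge: "inj_on hub_edge hub_pairs"
  by (auto simp: inj_on_def hub_edge_def hub_pairs_def doubleton_eq_iff)

lemma finite_nonroots: "finite nonroots"
  by (simp add: nonroots_def)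

lemma finite_hub_pairs: "finite hub_pairs"
  by (simp add: hub_pairs_def)

lemma simple_graph_G: "simple_graph G"
proof -
  have "tree_edge x \<subseteq> {..<M * V + k} \<and> card (tree_edge x) = 2" if "x \<in> nonroots" for x
    using that gpar_less[of x] by (auto simp: tree_edge_def nonroots_def card_2_iff doubleton_eq_iff)
  moreover have "hub_edge p \<subseteq> {..<M * V + k} \<and> card (hub_edge p) = 2" if "p \<in> hub_pairs" for p
    using that by (auto simp: hub_edge_def hub_pairs_def)
  ultimately have "e \<subseteq> {..<M * V + k} \<and> card e = 2" if "e \<in> edges G" for e
    using that unfolding G_def by (metis (no_types, lifting) Un_iff graph.select_convs(2) imageE)
  moreover have "verts G = {..<M * V + k}" by (simp add: G_def)
  moreover have "0 \<in> verts G" using k by (simp add: G_def)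
  then have "verts G \<noteq> {}" by auto
  ultimately show ?thesis unfolding simple_graph_def by simp
qed

text \<open>Additive form avoids truncated subtraction: there are \<open>M * (V - 1)\<close> tree
  edges, and \<open>M * V * k\<close> hub edges less the spares.\<close>

lemma card_edges_G:
  "card (edges G) + M + M * (\<Sum>z<V. spare z) = M * V + M * V * k"
proof -
  have "tree_edge ` nonroots \<inter> hub_edge ` hub_pairs = {}"
  proof -
    have "tree_edge x \<noteq> hub_edge p" if "x \<in> nonroots" for x p
      using that gpar_less[of x]
      by (auto simp: tree_edge_def hub_edge_def nonroots_def doubleton_eq_iff)
    then show ?thesis by blast
  qed
  then have "card (edges G) = card nonroots + card hub_pairs"
    using finite_nonroots finite_hub_pairs inj_tree_edge inj_hub_edge
    by (simp add: G_def card_Un_disjoint card_image)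
  moreover have "card nonroots + M = M * V"
  proof -
    have "card nonroots = (\<Sum>x<M * V. of_bool (x mod V \<noteq> 0))"
      by (simp add: nonroots_def of_bool_def sum.If_cases Int_def)
    also have "\<dots> = (\<Sum>c<M. \<Sum>z<V. of_bool (z \<noteq> 0))"
      unfolding sum_copies by simp
    also have "(\<Sum>z<V. of_bool (z \<noteq> 0)) = V - 1"
    proof -
      obtain n where "V = Suc n" using V_pos by (cases V) auto
      then show ?thesis by (simp add: sum.lessThan_Suc_shift del: sum.lessThan_Suc)
    qed
    finally show ?thesis using V_pos by (simp add: algebra_simps)
  qed
  moreover have "card hub_pairs + M * (\<Sum>z<V. spare z) = M * V * k"
  proof -
    have "card hub_pairs = (\<Sum>x<M * V. k - spare (x mod V))"
      by (simp add: hub_pairs_def)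
    also have "\<dots> = (\<Sum>c<M. \<Sum>z<V. k - spare z)"
      unfolding sum_copies by simp
    finally have "card hub_pairs + M * (\<Sum>z<V. spare z)
        = M * ((\<Sum>z<V. k - spare z) + (\<Sum>z<V. spare z))"
      by (simp add: algebra_simps)
    also have "(\<Sum>z<V. k - spare z) + (\<Sum>z<V. spare z) = V * k"
      unfolding sum.distrib[symmetric] using spare_le by simp
    finally show ?thesis by simp
  qed
  ultimately show ?thesis by simp
qed

section \<open>Fractional arboricity\<close>

lemma density_copies:
  assumes X: "X \<subseteq> {..<M * V}" and \<epsilon>: "\<epsilon> * (real N + 1) \<ge> 1" "\<epsilon> > 0"
  shows "rate * real (card X) \<le> real (card {x \<in> X. x mod V = 0 \<or> gpar x \<notin> X})
    + real (\<Sum>x\<in>X. spare (x mod V)) + \<epsilon> * real (card X)"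
proof -
  have fin: "finite X" using X finite_subset by blast
  define r where "r x \<longleftrightarrow> x mod V = 0 \<or> gpar x \<notin> X" for x
  \<comment> \<open>With \<open>\<epsilon>\<close> inside the weight, every copy has nonnegative
    total on its own, so the copies simply add up.\<close>
  define w where "w x = (if x \<in> X then of_bool (r x) + real (spare (x mod V)) + \<epsilon> - rate else 0)" for x
  have "(\<Sum>z<V. w (c * V + z)) \<ge> 0" for c
  proof -
    define Y where "Y = {z. z < V \<and> c * V + z \<in> X}"
    have Y: "Y \<subseteq> {..<V}" "finite Y" by (auto simp: Y_def)
    have root: "r (c * V + z) \<longleftrightarrow> is_root Y z" if "z \<in> Y" for z
      using that par_less_V[of z] by (auto simp: r_def is_root_def Y_def gpar_def)
    have "(\<Sum>z<V. w (c * V + z)) = (\<Sum>z\<in>Y. of_bool (is_root Y z) + real (spare z) + \<epsilon> - rate)"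
      using Y root by (intro sum.mono_neutral_cong_right) (auto simp: w_def Y_def)
    also have "\<dots> = real (card {z \<in> Y. is_root Y z}) + real (\<Sum>z\<in>Y. spare z)
        + \<epsilon> * real (card Y) - rate * real (card Y)"
      using Y by (simp add: sum.distrib sum_subtractf sum.If_cases of_bool_def Int_def)
    finally show ?thesis using density[OF Y(1) \<epsilon>] by linarith
  qed
  then have "(\<Sum>x<M * V. w x) \<ge> 0" unfolding sum_copies by (rule sum_nonneg)
  also have "(\<Sum>x<M * V. w x) = (\<Sum>x\<in>X. of_bool (r x) + real (spare (x mod V)) + \<epsilon> - rate)"
    using X by (intro sum.mono_neutral_cong_right) (auto simp: w_def)
  also have "\<dots> = real (card {x \<in> X. r x}) + real (\<Sum>x\<in>X. spare (x mod V))
      + \<epsilon> * real (card X) - rate * real (card X)"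
    using fin by (simp add: sum.distrib sum_subtractf sum.If_cases of_bool_def Int_def)
  finally show ?thesis unfolding r_def by linarith
qed

text \<open>Without hubs \<open>H\<close> is a forest. With some but not all hubs, each tree vertex
  accounts for at most \<open>k\<close> edges. With all hubs, the density bound of the tree applies.
  Any hub in \<open>H\<close> absorbs the \<open>- 1\<close>.\<close>

lemma subgraph_density:
  assumes H: "subgraph H G" "card (verts H) \<ge> 2"
    and \<epsilon>: "\<epsilon> * (real N + 1) \<ge> 1" "\<epsilon> > 0"
  shows "real (card (edges H)) \<le> (real k + 1 - rate + \<epsilon>) * (real (card (verts H)) - 1)"
proof -
  define X where "X = verts H \<inter> {..<M * V}"
  define A where "A = {j. j < k \<and> M * V + j \<in> verts H}"
  define T where "T = {x \<in> X. \<not> (x mod V = 0 \<or> gpar x \<notin> X)}"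
  define P where "P = {p \<in> hub_pairs. fst p \<in> X \<and> snd p \<in> A}"
  define \<beta> where "\<beta> = real k + 1 - rate + \<epsilon>"
  have fin: "finite X" "finite A" "finite T" "finite P"
    using finite_hub_pairs by (auto simp: X_def A_def T_def P_def)
  have vH: "verts H \<subseteq> {..<M * V + k}" using H by (simp add: subgraph_def G_def)
  have "verts H = X \<union> (\<lambda>j. M * V + j) ` A"
  proof
    show "verts H \<subseteq> X \<union> (\<lambda>j. M * V + j) ` A"
    proof
      fix x assume x: "x \<in> verts H"
      show "x \<in> X \<union> (\<lambda>j. M * V + j) ` A"
      proof (cases "x < M * V")
        case True
        then show ?thesis using x by (simp add: X_def)
      next
        case False
        then have "x = M * V + (x - M * V)" by simp
        moreover have "x - M * V \<in> A" using x vH False by (auto simp: A_def)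
        ultimately show ?thesis by blast
      qed
    qed
  qed (auto simp: X_def A_def)
  moreover have "X \<inter> (\<lambda>j. M * V + j) ` A = {}" by (auto simp: X_def)
  ultimately have cv: "card (verts H) = card X + card A"
    using fin by (simp add: card_Un_disjoint card_image)
  have A_le: "card A \<le> k" using card_mono[of "{..<k}" A] by (auto simp: A_def)
  have "edges H \<subseteq> tree_edge ` T \<union> hub_edge ` P"
  proof
    fix e assume e: "e \<in> edges H"
    then have eV: "e \<subseteq> verts H" using H by (auto simp: subgraph_def simple_graph_def)
    have "e \<in> edges G" using e H by (auto simp: subgraph_def)
    then consider x where "x \<in> nonroots" "e = tree_edge x"
      | p where "p \<in> hub_pairs" "e = hub_edge p" by (auto simp: G_def)
    then show "e \<in> tree_edge ` T \<union> hub_edge ` P"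
    proof cases
      case 1
      then have "x \<in> T"
        using eV gpar_less[of x] by (auto simp: T_def X_def tree_edge_def nonroots_def)
      then show ?thesis using 1 by blast
    next
      case 2
      then have "p \<in> P" using eV by (auto simp: P_def X_def A_def hub_edge_def hub_pairs_def)
      then show ?thesis using 2 by blast
    qed
  qed
  then have "card (edges H) \<le> card (tree_edge ` T \<union> hub_edge ` P)"
    using fin by (intro card_mono) auto
  also have "\<dots> \<le> card T + card P"
    using card_Un_le card_image_le fin by (meson add_le_mono le_trans)
  finally have ce: "card (edges H) \<le> card T + card P" .
  have "card T + card {x \<in> X. x mod V = 0 \<or> gpar x \<notin> X} = card X"
    unfolding T_def using fin by (subst card_Un_disjoint[symmetric]) (auto intro: arg_cong[of _ _ card])
  then have cT: "real (card T) = real (card X) - real (card {x \<in> X. x mod V = 0 \<or> gpar x \<notin> X})"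
    by linarith
  have T_le: "card T \<le> card X" using fin by (intro card_mono) (auto simp: T_def)
  have "P \<subseteq> X \<times> A" by (auto simp: P_def)
  then have P_le: "card P \<le> card X * card A"
    using fin card_mono[of "X \<times> A" P] by (simp add: card_cartesian_product)
  have "rate * 1 \<le> rate * real L" using rate_pos L by (intro mult_left_mono) auto
  then have \<beta>_ge: "\<beta> \<ge> real k" using rate_L \<epsilon> by (simp add: \<beta>_def)
  consider "card A = 0" | "1 \<le> card A" "card A < k" | "card A = k" using A_le by linarith
  then have "real (card (edges H)) \<le> \<beta> * (real (card (verts H)) - 1)"
  proof cases
    case 1
    then have cX: "card X \<ge> 2" using H cv by simp
    then have "X \<noteq> {}" by auto
    define m where "m = Min X"
    have "m \<in> X" using fin \<open>X \<noteq> {}\<close> by (simp add: m_def)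
    \<comment> \<open>The parent of the least vertex is smaller, so a forest has fewer edges than
      vertices.\<close>
    moreover have "m \<notin> T"
    proof
      assume "m \<in> T"
      then have "gpar m < m" "gpar m \<in> X" using gpar_less by (auto simp: T_def)
      then show False using Min_le[OF fin(1), of "gpar m"] unfolding m_def by linarith
    qed
    moreover have "T \<subseteq> X" by (auto simp: T_def)
    ultimately have "T \<subset> X" by blast
    then have "card T < card X" using fin psubset_card_mono by blast
    then have "real (card (edges H)) \<le> 1 * (real (card (verts H)) - 1)"
      using ce P_le cv 1 by simp
    also have "\<dots> \<le> \<beta> * (real (card (verts H)) - 1)"
      using \<beta>_ge k H by (intro mult_right_mono) auto
    finally show ?thesis .
  next
    case 2
    have "card (edges H) \<le> card X * (card A + 1)" using ce T_le P_le by simp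
    also have "\<dots> \<le> card X * k" using 2 by (intro mult_le_mono2) simp
    finally have "card (edges H) \<le> k * card X" by (simp add: mult.commute)
    then have "real (card (edges H)) \<le> real k * real (card X)"
      by (metis of_nat_le_iff of_nat_mult)
    also have "\<dots> \<le> \<beta> * (real (card (verts H)) - 1)"
      using \<beta>_ge 2 cv by (intro mult_mono) auto
    finally show ?thesis .
  next
    case 3
    have "P \<subseteq> (SIGMA x:X. {..<k - spare (x mod V)})" by (auto simp: P_def hub_pairs_def)
    then have "card P \<le> (\<Sum>x\<in>X. k - spare (x mod V))"
      using fin card_mono[of "SIGMA x:X. {..<k - spare (x mod V)}" P] by simp
    moreover have "(\<Sum>x\<in>X. k - spare (x mod V)) + (\<Sum>x\<in>X. spare (x mod V)) = card X * k"
      unfolding sum.distrib[symmetric] using spare_le by simp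
    ultimately have "card P + (\<Sum>x\<in>X. spare (x mod V)) \<le> card X * k" by linarith
    then have "real (card P) + real (\<Sum>x\<in>X. spare (x mod V)) \<le> real (card X) * real k"
      by (metis of_nat_add of_nat_le_iff of_nat_mult)
    moreover have "X \<subseteq> {..<M * V}" by (simp add: X_def)
    note density_copies[OF this \<epsilon>]
    ultimately have "real (card (edges H)) \<le> \<beta> * real (card X)"
      using ce cT by (simp add: \<beta>_def algebra_simps)
    also have "\<dots> \<le> \<beta> * (real (card (verts H)) - 1)"
      using \<beta>_ge cv 3 k by (intro mult_left_mono) auto
    finally show ?thesis .
  qed
  then show ?thesis by (simp add: \<beta>_def)
qed

lemma fractional_arboricity_G:
  assumes \<epsilon>: "\<epsilon> * (real N + 1) \<ge> 1" "\<epsilon> > 0" and M: "M \<ge> 1"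
  shows "fractional_arboricity G \<le> real k + 1 - rate + \<epsilon>"
proof -
  let ?S = "{real (card (edges H)) / (real (card (verts H)) - 1) | H.
            subgraph H G \<and> card (verts H) \<ge> 2}"
  \<comment> \<open>The quotient depends only on the vertex and edge sets, so only finitely many
    values occur.\<close>
  have "?S \<subseteq> (\<lambda>(U, E). real (card E) / (real (card U) - 1)) ` (Pow (verts G) \<times> Pow (edges G))"
    by (force simp: subgraph_def)
  moreover have "finite (verts G)" "finite (edges G)"
    using simple_graph_G finite_edges by (auto simp: simple_graph_def)
  ultimately have fin: "finite ?S" by (meson finite_Pow_iff finite_SigmaI finite_imageI finite_subset)
  have "subgraph G G" using simple_graph_G by (simp add: subgraph_def)
  moreover have "0 < M * V" using M V_pos by simp
  then have "M * V + k \<ge> 2" using k by linarith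
  then have "card (verts G) \<ge> 2" by (simp add: G_def)
  ultimately have ne: "?S \<noteq> {}" by blast
  have "s \<le> real k + 1 - rate + \<epsilon>" if "s \<in> ?S" for s
  proof -
    from that obtain H where H: "subgraph H G" "card (verts H) \<ge> 2"
      and s: "s = real (card (edges H)) / (real (card (verts H)) - 1)" by blast
    have "real (card (verts H)) - 1 > 0" using H by simp
    then show ?thesis using subgraph_density[OF H \<epsilon>] by (simp add: s pos_divide_le_eq)
  qed
  then show ?thesis unfolding fractional_arboricity_def using fin ne by simp
qed

section \<open>Nonexistence of the decomposition\<close>

text \<open>Walks in \<open>F\<close> cannot leave the copy through a hub, so the potential forces
  every walk between two ends to have at least \<open>2 * L - 1 + \<alpha>\<close> edges.\<close>

lemma ends_disconnected:
  assumes F: "F \<subseteq> edges G" "simple_graph (spanning G F)" and c: "c < M"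
    and no_hub: "\<And>p. p \<in> hub_pairs \<Longrightarrow> hub_edge p \<in> F \<Longrightarrow> fst p div V \<noteq> c"
    and diam: "\<And>C. component C (spanning G F) \<Longrightarrow> graph_diameter C < 2 * L - 1 + \<alpha>"
    and uv: "u \<in> path_ends" "v \<in> path_ends" "u \<noteq> v"
  shows "(c * V + u, c * V + v) \<notin> (adj (spanning G F))\<^sup>*"
proof
  let ?H = "spanning G F"
  let ?C = "component_of ?H (c * V + u)"
  assume reach: "(c * V + u, c * V + v) \<in> (adj ?H)\<^sup>*"
  have uvV: "u < V" "v < V" using uv by (auto simp: path_ends_def)
  then have "c * V + u \<in> verts ?H" using copy_less[OF c] by (simp add: spanning_def G_def trans_less_add1)
  then have C: "component ?C ?H" using F by (intro component_component_of)
  \<comment> \<open>The value 0 off the copy is harmless, since no edge of \<open>F\<close> leaves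
    the copy.\<close>
  define \<psi> where "\<psi> x = (if x div V = c then potential u v (x mod V) else 0)" for x
  have tree: "\<bar>\<psi> w - \<psi> (gpar w)\<bar> \<le> 1" if "w \<in> nonroots" for w
    using that potential_lipschitz[of "w mod V" u v] gpar_div_mod[of w]
    by (simp add: \<psi>_def nonroots_def)
  have lip: "\<bar>\<psi> x - \<psi> y\<bar> \<le> 1" if xy: "{x, y} \<in> F" for x y
  proof -
    consider w where "w \<in> nonroots" "{x, y} = tree_edge w"
      | p where "p \<in> hub_pairs" "{x, y} = hub_edge p" using xy F by (auto simp: G_def)
    then show ?thesis
    proof cases
      case 1
      then show ?thesis using tree[OF 1(1)] by (auto simp: tree_edge_def doubleton_eq_iff)
    next
      case 2
      have "\<psi> (M * V + snd p) = 0" using c V_pos by (simp add: \<psi>_def)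
      moreover have "\<psi> (fst p) = 0" using no_hub[of p] 2 xy by (simp add: \<psi>_def)
      ultimately show ?thesis using 2 by (auto simp: hub_edge_def doubleton_eq_iff)
    qed
  qed
  have "2 * L - 1 + \<alpha> \<le> graph_diameter ?C"
  proof (rule le_graph_diameter)
    show "simple_graph ?C" "connected_graph ?C" using C by (auto simp: component_def subgraph_def)
    show "c * V + u \<in> verts ?C" "c * V + v \<in> verts ?C"
      using reach by (auto simp: component_of_def)
    fix p assume p: "walk_betw ?C (c * V + u) p (c * V + v)"
    have "successively (\<lambda>x y. {x, y} \<in> F) p" "p \<noteq> []"
      using p by (auto simp: walk_betw_def component_of_def spanning_def elim: successively_mono)
    from lipschitz_walk[of F p \<psi>, OF this lip]
    have "\<psi> (c * V + v) - \<psi> (c * V + u) \<le> int (length p) - 1"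
      using p by (simp add: walk_betw_def)
    then show "2 * L - 1 + \<alpha> < length p"
      using uvV potential_left[OF uv(1)] potential_right[OF uv] L by (simp add: \<psi>_def)
  qed
  then show False using diam[OF C] by simp
qed

text \<open>Following parents maps the path ends injectively to the roots of the components of
  \<open>F\<close> inside the copy.\<close>

lemma card_copy_edges:
  assumes c: "c < M" and F: "F \<subseteq> edges G"
    and disc: "\<And>u v. u \<in> path_ends \<Longrightarrow> v \<in> path_ends \<Longrightarrow> u \<noteq> v \<Longrightarrow>
      (c * V + u, c * V + v) \<notin> (adj (spanning G F))\<^sup>*"
  shows "card {z. 0 < z \<and> z < V \<and> tree_edge (c * V + z) \<in> F} + card path_ends \<le> V"
proof -
  let ?R = "(adj (spanning G F))\<^sup>*"
  define T where "T = {z. 0 < z \<and> z < V \<and> tree_edge (c * V + z) \<in> F}"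
  have "\<exists>r. r < V \<and> r \<notin> T \<and> (c * V + z, c * V + r) \<in> ?R" if "z < V" for z
    using that
  proof (induction z rule: less_induct)
    case (less z)
    show ?case
    proof (cases "z \<in> T")
      case True
      then have z: "0 < z" "tree_edge (c * V + z) \<in> F" by (auto simp: T_def)
      then have "par z < z" "par z < V" using par_less par_less_V less.prems by auto
      then obtain r where r: "r < V" "r \<notin> T" "(c * V + par z, c * V + r) \<in> ?R"
        using less.IH by blast
      have "gpar (c * V + z) = c * V + par z" using less.prems by (simp add: gpar_def)
      then have "(c * V + z, c * V + par z) \<in> adj (spanning G F)"
        using z copy_less[OF c less.prems] copy_less[OF c \<open>par z < V\<close>]
        by (auto simp: adj_def spanning_def G_def tree_edge_def)
      then show ?thesis using r by (meson converse_rtrancl_into_rtrancl)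
    next
      case False
      then show ?thesis using less.prems by blast
    qed
  qed
  then obtain f where f: "\<And>z. z < V \<Longrightarrow> f z < V \<and> f z \<notin> T \<and> (c * V + z, c * V + f z) \<in> ?R"
    by metis
  have "inj_on f path_ends"
  proof (rule inj_onI, rule ccontr)
    fix u v assume *: "u \<in> path_ends" "v \<in> path_ends" "f u = f v" "u \<noteq> v"
    then have "(c * V + u, c * V + f u) \<in> ?R" "(c * V + v, c * V + f u) \<in> ?R"
      using f[of u] f[of v] by (auto simp: path_ends_def)
    then have "(c * V + u, c * V + v) \<in> ?R" using adj_rtrancl_sym rtrancl_trans by metis
    then show False using disc * by blast
  qed
  moreover have "f ` path_ends \<subseteq> {..<V} - T" using f by (auto simp: path_ends_def)
  ultimately have "card path_ends \<le> card ({..<V} - T)" by (intro card_inj_on_le) auto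
  also have "\<dots> = V - card T" by (subst card_Diff_subset) (auto simp: T_def)
  finally have "card path_ends \<le> V - card T" .
  moreover have "card T \<le> V" using card_mono[of "{..<V}" T] by (auto simp: T_def)
  ultimately show ?thesis by (simp add: T_def)
qed

text \<open>The \<open>k\<close> other parts have at most \<open>M * V + k\<close> edges each, and
  the chosen part has at most \<open>V - S - 2\<close> tree edges in every copy that its hub edges
  avoid. Up to terms independent of \<open>M\<close>, this falls short of the edges of
  \<open>G\<close> by one per copy.\<close>

lemma no_decomposition:
  assumes dec: "decomposition G (k + 1) F"
    and pf: "\<And>i. i < k + 1 \<Longrightarrow> pseudoforest (spanning G (F i))"
    and j: "j < k + 1" and deg: "max_degree (spanning G (F j)) \<le> D"
    and diam: "\<And>C. component C (spanning G (F j)) \<Longrightarrow> graph_diameter C < 2 * L - 1 + \<alpha>"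
  shows "M \<le> k * k + k * D + k * D * ((\<Sum>z<V. spare z) + 1)"
proof -
  define S where "S = (\<Sum>z<V. spare z)"
  have Fj: "F j \<subseteq> edges G" using dec j by (auto simp: decomposition_def)
  have finE: "finite (edges G)" using simple_graph_G by (rule finite_edges)
  have finF: "finite (F i)" if "i < k + 1" for i
    using dec that finE by (auto simp: decomposition_def intro: finite_subset)
  have F_le: "card (F i) \<le> M * V + k" if "i < k + 1" for i
    using pseudoforest_card_edges[OF pf[OF that]] by (simp add: spanning_def G_def)
  have "card (\<Union>i<k + 1. F i) = (\<Sum>i<k + 1. card (F i))"
    using dec finF by (intro card_UN_disjoint) (auto simp: decomposition_def disjoint_family_on_def)
  then have "card (edges G) = (\<Sum>i<k + 1. card (F i))"
    using dec unfolding decomposition_def by metis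
  moreover have "\<dots> = card (F j) + (\<Sum>i\<in>{..<k + 1} - {j}. card (F i))"
    using j by (intro sum.remove) auto
  moreover have "(\<Sum>i\<in>{..<k + 1} - {j}. card (F i)) \<le> card ({..<k + 1} - {j}) * (M * V + k)"
    using sum_bounded_above[of "{..<k + 1} - {j}" "\<lambda>i. card (F i)" "M * V + k"] F_le by simp
  moreover have "card ({..<k + 1} - {j}) = k" using j by simp
  ultimately have cE: "card (edges G) \<le> card (F j) + k * (M * V + k)" by simp

  \<comment> \<open>The degree bound allows at most \<open>D\<close> of these at each hub.\<close>
  define Q where "Q = {p \<in> hub_pairs. hub_edge p \<in> F j}"
  have finQ: "finite Q" using finite_hub_pairs by (simp add: Q_def)
  have "card {p \<in> Q. snd p = i} \<le> D" if "i < k" for i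
  proof -
    have v: "M * V + i \<in> verts (spanning G (F j))" using that by (simp add: spanning_def G_def)
    have "card {p \<in> Q. snd p = i} \<le> card {e \<in> F j. M * V + i \<in> e}"
      using finF[OF j] inj_on_subset[OF inj_hub_edge]
      by (intro card_inj_on_le[of hub_edge]) (auto simp: Q_def hub_edge_def)
    also have "\<dots> = degree (spanning G (F j)) (M * V + i)" by (simp add: degree_def spanning_def)
    also have "\<dots> \<le> max_degree (spanning G (F j))"
      unfolding max_degree_def using v by (intro Max_ge) (auto simp: spanning_def G_def)
    finally show ?thesis using deg by simp
  qed
  then have "(\<Sum>i<k. card {p \<in> Q. snd p = i}) \<le> (\<Sum>i<k. D)" by (intro sum_mono) auto
  moreover have union: "(\<Union>i<k. {p \<in> Q. snd p = i}) = Q" by (auto simp: Q_def hub_pairs_def)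
  have "card (\<Union>i<k. {p \<in> Q. snd p = i}) \<le> (\<Sum>i<k. card {p \<in> Q. snd p = i})"
    by (rule card_UN_le) simp
  then have "card Q \<le> (\<Sum>i<k. card {p \<in> Q. snd p = i})" unfolding union .
  ultimately have cQ: "card Q \<le> k * D" by simp

  define T where "T c = {z. 0 < z \<and> z < V \<and> tree_edge (c * V + z) \<in> F j}" for c
  have finT: "finite (T c)" for c by (simp add: T_def)
  define \<T> where "\<T> = (SIGMA c:{..<M}. T c)"
  have "F j \<subseteq> (\<lambda>(c, z). tree_edge (c * V + z)) ` \<T> \<union> hub_edge ` Q"
  proof
    fix e assume e: "e \<in> F j"
    then consider x where "x \<in> nonroots" "e = tree_edge x" | p where "p \<in> hub_pairs" "e = hub_edge p"
      using Fj by (auto simp: G_def)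
    then show "e \<in> (\<lambda>(c, z). tree_edge (c * V + z)) ` \<T> \<union> hub_edge ` Q"
    proof cases
      case 1
      then have "(x div V, x mod V) \<in> \<T>"
        using e div_less_M V_pos by (auto simp: \<T>_def T_def nonroots_def)
      then show ?thesis using 1 by force
    next
      case 2
      then show ?thesis using e by (auto simp: Q_def)
    qed
  qed
  then have "card (F j) \<le> card ((\<lambda>(c, z). tree_edge (c * V + z)) ` \<T> \<union> hub_edge ` Q)"
    using finQ finT by (intro card_mono) (auto simp: \<T>_def)
  also have "\<dots> \<le> card \<T> + card Q"
    using finQ finT by (intro order_trans[OF card_Un_le] add_mono card_image_le) (auto simp: \<T>_def)
  also have "card \<T> = (\<Sum>c<M. card (T c))" using finT by (simp add: \<T>_def)
  finally have cF: "card (F j) \<le> (\<Sum>c<M. card (T c)) + card Q" .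

  define bad where "bad = (\<lambda>p. fst p div V) ` Q"
  \<comment> \<open>A bad copy gets the trivial bound \<open>V - 1\<close>, hence the correction
    \<open>S + 1\<close>; there are at most \<open>k * D\<close> bad copies.\<close>
  have T_le: "card (T c) + (S + 2) \<le> V + (if c \<in> bad then S + 1 else 0)" if c: "c < M" for c
  proof (cases "c \<in> bad")
    case True
    have "card (T c) \<le> card ({..<V} - {0})" by (intro card_mono) (auto simp: T_def)
    then show ?thesis using True V_pos by simp
  next
    case False
    have "card (T c) + card path_ends \<le> V"
      unfolding T_def
    proof (rule card_copy_edges[OF c Fj], rule ends_disconnected[OF Fj _ c _ diam])
      show "simple_graph (spanning G (F j))" using pf[OF j] by (simp add: pseudoforest_def)
      show "fst p div V \<noteq> c" if "p \<in> hub_pairs" "hub_edge p \<in> F j" for p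
        using False that by (auto simp: bad_def Q_def)
    qed
    then show ?thesis using False sum_spare_path_ends by (simp add: S_def)
  qed
  have "card ({..<M} \<inter> bad) \<le> card bad" using finQ by (intro card_mono) (auto simp: bad_def)
  moreover have "card bad \<le> card Q" using finQ by (simp add: bad_def card_image_le)
  ultimately have "card ({..<M} \<inter> bad) \<le> k * D" using cQ by linarith
  then have "card ({..<M} \<inter> bad) * (S + 1) \<le> k * D * (S + 1)" by (rule mult_le_mono1)
  moreover have "(\<Sum>c<M. card (T c) + (S + 2)) \<le> (\<Sum>c<M. V + (if c \<in> bad then S + 1 else 0))"
    by (rule sum_mono, rule T_le) simp
  moreover have "(\<Sum>c<M. card (T c) + (S + 2)) = (\<Sum>c<M. card (T c)) + M * (S + 2)"
    unfolding sum.distrib by simp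
  moreover have "(\<Sum>c<M. V + (if c \<in> bad then S + 1 else 0)) = M * V + card ({..<M} \<inter> bad) * (S + 1)"
    unfolding sum.distrib by (simp add: sum.If_cases)
  ultimately have sT: "(\<Sum>c<M. card (T c)) + M * (S + 2) \<le> M * V + k * D * (S + 1)"
    by linarith
  have "card (edges G) + M + M * S = M * V + k * (M * V)"
    using card_edges_G by (simp add: S_def mult.commute)
  moreover have "M * (S + 2) = M * S + M + M" "k * (M * V + k) = k * (M * V) + k * k"
    by (simp_all add: algebra_simps)
  ultimately show ?thesis
    using cE cF cQ sT unfolding S_def[symmetric] by linarith
qed

end

theorem theorem1p8:
  fixes k l D \<alpha> :: nat and \<epsilon> :: real
  assumes "k \<ge> 1" and "\<epsilon> > 0" and "\<alpha> \<in> {0, 1}"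
  shows "\<exists>G :: nat graph. simple_graph G \<and>
    fractional_arboricity G <
      real k + (real l * (real k + 1) + real \<alpha>) / ((real l + 1) * (real k + 1) + real \<alpha>) + \<epsilon> \<and>
    \<not> (\<exists>F. decomposition G (k + 1) F \<and>
          (\<forall>i<k + 1. pseudoforest (spanning G (F i))) \<and>
          (\<exists>j<k + 1. max_degree (spanning G (F j)) \<le> D \<and>
             (\<forall>C. component C (spanning G (F j)) \<longrightarrow> graph_diameter C < 2 * l + 1 + \<alpha>)))"
proof -
  \<comment> \<open>Half of \<open>\<epsilon>\<close> is the tolerance in the arboricity bound; the
    other half makes the inequality strict.\<close>
  obtain N :: nat where N: "2 / \<epsilon> < real N" using reals_Archimedean2 by blast
  then have "2 < \<epsilon> * real N" using \<open>\<epsilon> > 0\<close> by (simp add: field_simps)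
  then have \<epsilon>: "\<epsilon> / 2 * (real N + 1) \<ge> 1" "\<epsilon> / 2 > 0"
    using \<open>\<epsilon> > 0\<close> by (auto simp: field_simps)
  have "N \<ge> 1" using \<open>2 < \<epsilon> * real N\<close> by (cases N) auto
  then interpret caterpillar k "l + 1" \<alpha> N
    using assms by unfold_locales auto
  \<comment> \<open>One more copy than \<open>no_decomposition\<close> allows.\<close>
  define M where "M = k * k + k * D + k * D * ((\<Sum>z<V. spare z) + 1) + 1"
  interpret caterpillars k "l + 1" \<alpha> N M ..
  have B: "real B = (real l + 1) * (real k + 1) + real \<alpha>"
    unfolding B_def by (simp add: algebra_simps)
  then have num: "real l * (real k + 1) + real \<alpha> = real B - (real k + 1)"
    by (simp add: algebra_simps)
  have "real k + 1 - rate
      = real k + (real l * (real k + 1) + real \<alpha>) / ((real l + 1) * (real k + 1) + real \<alpha>)"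
    using B_pos unfolding rate_def B[symmetric] num by (simp add: diff_divide_distrib)
  then have "fractional_arboricity G
      < real k + (real l * (real k + 1) + real \<alpha>) / ((real l + 1) * (real k + 1) + real \<alpha>) + \<epsilon>"
    using fractional_arboricity_G[OF \<epsilon>] \<open>\<epsilon> > 0\<close> by (simp add: M_def)
  moreover have False
    if F: "decomposition G (k + 1) F" "\<forall>i<k + 1. pseudoforest (spanning G (F i))"
      "j < k + 1" "max_degree (spanning G (F j)) \<le> D"
      "\<forall>C. component C (spanning G (F j)) \<longrightarrow> graph_diameter C < 2 * l + 1 + \<alpha>" for F j
    using no_decomposition[of F j D] F by (simp add: M_def)
  ultimately show ?thesis using simple_graph_G by blast
qed

end
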